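(* Let $\mathcal{E}$ be an $\mathcal{A}$-module on $X$. If $\mathcal{F}$ is a sub-$\mathcal{A}$-module of $\mathcal{E}$, then $(\mathcal{E}/\mathcal{F})^\ast=\mathcal{F}^\perp$ within an $\mathcal{A}$-isomorphism.
   Context: $X$ is a topological space and $\mathcal{A}$ is a sheaf of unital commutative $\mathbb{C}$-algebras on $X$; an $\mathcal{A}$-module is a sheaf of $\mathcal{A}$-modules on $X$. A sub-$\mathcal{A}$-module is a subsheaf that is an $\mathcal{A}$-module with inclusion an $\mathcal{A}$-morphism. The dual of an $\mathcal{A}$-module $\mathcal{E}$ is $\mathcal{E}^\ast=\mathcal{H}om_{\mathcal{A}}(\mathcal{E},\mathcal{A})$, so $\mathcal{E}^\ast(U)=\mathrm{Hom}_{\mathcal{A}|_U}(\mathcal{E}|_U,\mathcal{A}|_U)$. The annihilator sheaf $\mathcal{F}^\perp\subseteq\mathcal{E}^\ast$ of $\mathcal{F}$ is the sheaf generated by the presheaf $U\mapsto\mathcal{F}(U)^\perp$, where $\mathcal{F}(U)^\perp$ is the set of $t=(t_V)_{V\subseteq U}\in\mathcal{E}^\ast(U)$ such that $t_V(s)=0$ for all open $V\subseteq U$ and all $s\in\mathcal{F}(V)$, with restriction maps those of $\mathcal{E}^\ast$. *)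

theory Defs
  imports
    "HOL-Analysis.Abstract_Topology"
    "HOL-Algebra.Algebraic_Closure_Type"
    "HOL-Algebra.Module"
    "HOL-Algebra.AbelCoset"
begin

section \<open>Presheaves and sheaves\<close>

text \<open>
  \<open>'a\<close> is the type of points, \<open>'x\<close> the type in which all sections live, and \<open>'s\<close> the type of the
  algebraic structures (records with a carrier) carried by the sets of sections. \<open>restr F U V\<close> is
  the restriction map from \<open>U\<close> to \<open>V \<subseteq> U\<close>. Values at sets that are not open are irrelevant.
\<close>

record ('a, 'x, 's) presheaf_data =
  sections :: "'a set \<Rightarrow> 's"
  restr :: "'a set \<Rightarrow> 'a set \<Rightarrow> 'x \<Rightarrow> 'x"

locale presheaf =
  fixes T :: "'a topology"
    and F :: "('a, 'x, ('x, 'm) partial_object_scheme) presheaf_data"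
  assumes restr_closed:
      "\<lbrakk>openin T U; openin T V; V \<subseteq> U; s \<in> carrier (sections F U)\<rbrakk>
        \<Longrightarrow> restr F U V s \<in> carrier (sections F V)"
    and restr_id:
      "\<lbrakk>openin T U; s \<in> carrier (sections F U)\<rbrakk> \<Longrightarrow> restr F U U s = s"
    and restr_restr:
      "\<lbrakk>openin T U; openin T V; openin T W; W \<subseteq> V; V \<subseteq> U; s \<in> carrier (sections F U)\<rbrakk>
        \<Longrightarrow> restr F V W (restr F U V s) = restr F U W s"

locale sheaf = presheaf +
  assumes locality:
      "\<lbrakk>\<forall>U\<in>\<C>. openin T U; s \<in> carrier (sections F (\<Union>\<C>)); t \<in> carrier (sections F (\<Union>\<C>));
        \<forall>U\<in>\<C>. restr F (\<Union>\<C>) U s = restr F (\<Union>\<C>) U t\<rbrakk> \<Longrightarrow> s = t"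
    and gluing:
      "\<lbrakk>\<forall>U\<in>\<C>. openin T U; \<forall>U\<in>\<C>. \<sigma> U \<in> carrier (sections F U);
        \<forall>U\<in>\<C>. \<forall>V\<in>\<C>. restr F U (U \<inter> V) (\<sigma> U) = restr F V (U \<inter> V) (\<sigma> V)\<rbrakk>
        \<Longrightarrow> \<exists>s\<in>carrier (sections F (\<Union>\<C>)). \<forall>U\<in>\<C>. restr F (\<Union>\<C>) U s = \<sigma> U"

type_synonym ('a, 'r) algebra_data = "('a, 'r, (complex, 'r) module) presheaf_data"
type_synonym ('a, 'r, 'e) module_data = "('a, 'e, ('r, 'e) module) presheaf_data"

text \<open>Sheaves of unital commutative \<open>\<complex>\<close>-algebras; \<open>ring_of_type_algebra\<close> is the field of
  complex numbers as a structure with carrier, and \<open>ring_hom\<close> includes preservation of 1.\<close>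

locale algebra_sheaf = sheaf T A
  for T :: "'a topology" and A :: "('a, 'r) algebra_data" +
  assumes algebra_sections:
      "openin T U \<Longrightarrow> algebra (ring_of_type_algebra :: complex ring) (sections A U)"
    and restr_ring_hom:
      "\<lbrakk>openin T U; openin T V; V \<subseteq> U\<rbrakk>
        \<Longrightarrow> restr A U V \<in> ring_hom (sections A U) (sections A V)"
    and restr_scalar:
      "\<lbrakk>openin T U; openin T V; V \<subseteq> U; s \<in> carrier (sections A U)\<rbrakk>
        \<Longrightarrow> restr A U V (c \<odot>\<^bsub>sections A U\<^esub> s) = c \<odot>\<^bsub>sections A V\<^esub> restr A U V s"

text \<open>The \<open>mult\<close> and \<open>one\<close> fields of a \<open>module\<close> record play no role for modules.\<close>

locale module_sheaf = A: algebra_sheaf T A + E: sheaf T E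
  for T :: "'a topology" and A :: "('a, 'r) algebra_data" and E :: "('a, 'r, 'e) module_data" +
  assumes module_sections:
      "openin T U \<Longrightarrow> module (sections A U) (sections E U)"
    and restr_add:
      "\<lbrakk>openin T U; openin T V; V \<subseteq> U; s \<in> carrier (sections E U); t \<in> carrier (sections E U)\<rbrakk>
        \<Longrightarrow> restr E U V (s \<oplus>\<^bsub>sections E U\<^esub> t) = restr E U V s \<oplus>\<^bsub>sections E V\<^esub> restr E U V t"
    and restr_smult:
      "\<lbrakk>openin T U; openin T V; V \<subseteq> U; a \<in> carrier (sections A U); s \<in> carrier (sections E U)\<rbrakk>
        \<Longrightarrow> restr E U V (a \<odot>\<^bsub>sections E U\<^esub> s) = restr A U V a \<odot>\<^bsub>sections E V\<^esub> restr E U V s"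


section \<open>Morphisms\<close>

text \<open>Maps are taken in extensional form, so that equal homomorphisms are equal as HOL functions.\<close>

definition linear_maps ::
  "('r, 'm) ring_scheme \<Rightarrow> ('r, 'e) module \<Rightarrow> ('r, 'g) module \<Rightarrow> ('e \<Rightarrow> 'g) set" where
  "linear_maps R M N = {h \<in> carrier M \<rightarrow>\<^sub>E carrier N.
     (\<forall>x\<in>carrier M. \<forall>y\<in>carrier M. h (x \<oplus>\<^bsub>M\<^esub> y) = h x \<oplus>\<^bsub>N\<^esub> h y) \<and>
     (\<forall>a\<in>carrier R. \<forall>x\<in>carrier M. h (a \<odot>\<^bsub>M\<^esub> x) = a \<odot>\<^bsub>N\<^esub> h x)}"

definition sheaf_homs ::
  "'a topology \<Rightarrow> ('a, 'r) algebra_data \<Rightarrow> ('a, 'r, 'e) module_data \<Rightarrow> ('a, 'r, 'g) module_data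
    \<Rightarrow> ('a set \<Rightarrow> 'e \<Rightarrow> 'g) set" where
  "sheaf_homs T A E G =
    {\<phi> \<in> (\<Pi>\<^sub>E U\<in>{U. openin T U}. linear_maps (sections A U) (sections E U) (sections G U)).
      \<forall>U V. openin T U \<longrightarrow> openin T V \<longrightarrow> V \<subseteq> U \<longrightarrow>
        (\<forall>s\<in>carrier (sections E U). \<phi> V (restr E U V s) = restr G U V (\<phi> U s))}"

definition sheaf_isomorphic ::
  "'a topology \<Rightarrow> ('a, 'r) algebra_data \<Rightarrow> ('a, 'r, 'e) module_data \<Rightarrow> ('a, 'r, 'g) module_data
    \<Rightarrow> bool" where
  "sheaf_isomorphic T A E G \<longleftrightarrow>
    (\<exists>\<phi>\<in>sheaf_homs T A E G. \<exists>\<psi>\<in>sheaf_homs T A G E. \<forall>U. openin T U \<longrightarrow>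
      (\<forall>s\<in>carrier (sections E U). \<psi> U (\<phi> U s) = s) \<and>
      (\<forall>t\<in>carrier (sections G U). \<phi> U (\<psi> U t) = t))"

definition submodule_sheaf ::
  "'a topology \<Rightarrow> ('a, 'r) algebra_data \<Rightarrow> ('a, 'r, 'e) module_data \<Rightarrow> ('a, 'r, 'e) module_data
    \<Rightarrow> bool" where
  "submodule_sheaf T A F E \<longleftrightarrow>
    module_sheaf T A F \<and>
    (\<forall>U. openin T U \<longrightarrow> carrier (sections F U) \<subseteq> carrier (sections E U)) \<and>
    (\<lambda>U\<in>{U. openin T U}. \<lambda>s\<in>carrier (sections F U). s) \<in> sheaf_homs T A F E"


section \<open>Sheaf Hom and dual\<close>

text \<open>The restriction of a sheaf to an open set \<open>U\<close> has the same data, regarded over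
  \<open>subtopology T U\<close>, whose open sets are the open sets of \<open>T\<close> contained in \<open>U\<close>.\<close>

definition hom_sheaf ::
  "'a topology \<Rightarrow> ('a, 'r) algebra_data \<Rightarrow> ('a, 'r, 'e) module_data \<Rightarrow> ('a, 'r, 'g) module_data
    \<Rightarrow> ('a, 'r, 'a set \<Rightarrow> 'e \<Rightarrow> 'g) module_data" where
  "hom_sheaf T A E G = \<lparr>
     sections = (\<lambda>U. \<lparr>
       carrier = sheaf_homs (subtopology T U) A E G,
       monoid.mult = undefined,
       monoid.one = undefined,
       zero = (\<lambda>V\<in>{V. openin (subtopology T U) V}. \<lambda>s\<in>carrier (sections E V). \<zero>\<^bsub>sections G V\<^esub>),
       add = (\<lambda>\<phi> \<psi>. \<lambda>V\<in>{V. openin (subtopology T U) V}. \<lambda>s\<in>carrier (sections E V).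
         \<phi> V s \<oplus>\<^bsub>sections G V\<^esub> \<psi> V s),
       module.smult = (\<lambda>a \<phi>. \<lambda>V\<in>{V. openin (subtopology T U) V}. \<lambda>s\<in>carrier (sections E V).
         restr A U V a \<odot>\<^bsub>sections G V\<^esub> \<phi> V s)\<rparr>),
     restr = (\<lambda>U V \<phi>. restrict \<phi> {W. openin (subtopology T V) W})\<rparr>"

definition structure_module :: "('a, 'r) algebra_data \<Rightarrow> ('a, 'r, 'r) module_data" where
  "structure_module A = \<lparr>
     sections = (\<lambda>U. \<lparr>carrier = carrier (sections A U), monoid.mult = monoid.mult (sections A U),
       monoid.one = monoid.one (sections A U), zero = ring.zero (sections A U), add = ring.add (sections A U),
       module.smult = monoid.mult (sections A U)\<rparr>),
     restr = restr A\<rparr>"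

definition dual ::
  "'a topology \<Rightarrow> ('a, 'r) algebra_data \<Rightarrow> ('a, 'r, 'e) module_data
    \<Rightarrow> ('a, 'r, 'a set \<Rightarrow> 'e \<Rightarrow> 'r) module_data" where
  "dual T A E = hom_sheaf T A E (structure_module A)"


section \<open>The sheaf generated by a presheaf\<close>

definition germ ::
  "'a topology \<Rightarrow> ('a, 'x, ('x, 'm) partial_object_scheme) presheaf_data
    \<Rightarrow> 'a \<Rightarrow> 'a set \<Rightarrow> 'x \<Rightarrow> ('a set \<times> 'x) set" where
  "germ T P x U s = {(V, t). openin T V \<and> x \<in> V \<and> t \<in> carrier (sections P V) \<and>
     (\<exists>W. openin T W \<and> x \<in> W \<and> W \<subseteq> U \<inter> V \<and> restr P U W s = restr P V W t)}"

text \<open>The stalk operations are computed on representatives. The result does not depend on their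
  choice, so each union below is over a family of equal sets. In \<open>germ_smult\<close> the scalar \<open>a\<close> is a
  section of \<open>A\<close> over \<open>U\<close>.\<close>

definition germ_add ::
  "'a topology \<Rightarrow> ('a, 'r, 'e) module_data \<Rightarrow> 'a
    \<Rightarrow> ('a set \<times> 'e) set \<Rightarrow> ('a set \<times> 'e) set \<Rightarrow> ('a set \<times> 'e) set" where
  "germ_add T P x g h = (\<Union>(U, s)\<in>g. \<Union>(V, t)\<in>h.
     germ T P x (U \<inter> V) (restr P U (U \<inter> V) s \<oplus>\<^bsub>sections P (U \<inter> V)\<^esub> restr P V (U \<inter> V) t))"

definition germ_smult ::
  "'a topology \<Rightarrow> ('a, 'r) algebra_data \<Rightarrow> ('a, 'r, 'e) module_data \<Rightarrow> 'a
    \<Rightarrow> 'a set \<Rightarrow> 'r \<Rightarrow> ('a set \<times> 'e) set \<Rightarrow> ('a set \<times> 'e) set" where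
  "germ_smult T A P x U a g = (\<Union>(V, s)\<in>g.
     germ T P x (U \<inter> V) (restr A U (U \<inter> V) a \<odot>\<^bsub>sections P (U \<inter> V)\<^esub> restr P V (U \<inter> V) s))"

text \<open>Sections of the generated sheaf are the functions to the stalks that are locally given by
  sections of the presheaf, i.e. the continuous sections of its etale space.\<close>

definition generated_sheaf ::
  "'a topology \<Rightarrow> ('a, 'r) algebra_data \<Rightarrow> ('a, 'r, 'e) module_data
    \<Rightarrow> ('a, 'r, 'a \<Rightarrow> ('a set \<times> 'e) set) module_data" where
  "generated_sheaf T A P = \<lparr>
     sections = (\<lambda>U. \<lparr>
       carrier = {\<sigma> \<in> extensional U. \<forall>x\<in>U. \<exists>V. openin T V \<and> x \<in> V \<and> V \<subseteq> U \<and>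
         (\<exists>s\<in>carrier (sections P V). \<forall>y\<in>V. \<sigma> y = germ T P y V s)},
       monoid.mult = undefined,
       monoid.one = undefined,
       zero = (\<lambda>x\<in>U. germ T P x U \<zero>\<^bsub>sections P U\<^esub>),
       add = (\<lambda>\<sigma> \<tau>. \<lambda>x\<in>U. germ_add T P x (\<sigma> x) (\<tau> x)),
       module.smult = (\<lambda>a \<sigma>. \<lambda>x\<in>U. germ_smult T A P x U a (\<sigma> x))\<rparr>),
     restr = (\<lambda>U V \<sigma>. restrict \<sigma> V)\<rparr>"


section \<open>Quotient and annihilator\<close>

definition quotient_presheaf ::
  "('a, 'r, 'e) module_data \<Rightarrow> ('a, 'r, 'e) module_data \<Rightarrow> ('a, 'r, 'e set) module_data" where
  "quotient_presheaf E F = \<lparr>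
     sections = (\<lambda>U. \<lparr>
       carrier = a_rcosets\<^bsub>sections E U\<^esub> (carrier (sections F U)),
       monoid.mult = undefined,
       monoid.one = undefined,
       zero = carrier (sections F U),
       add = set_add (sections E U),
       module.smult = (\<lambda>a C. \<Union>s\<in>C. carrier (sections F U) +>\<^bsub>sections E U\<^esub> (a \<odot>\<^bsub>sections E U\<^esub> s))\<rparr>),
     restr = (\<lambda>U V C. \<Union>s\<in>C. carrier (sections F V) +>\<^bsub>sections E V\<^esub> restr E U V s)\<rparr>"

definition quotient_sheaf ::
  "'a topology \<Rightarrow> ('a, 'r) algebra_data \<Rightarrow> ('a, 'r, 'e) module_data \<Rightarrow> ('a, 'r, 'e) module_data
    \<Rightarrow> ('a, 'r, 'a \<Rightarrow> ('a set \<times> 'e set) set) module_data" where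
  "quotient_sheaf T A E F = generated_sheaf T A (quotient_presheaf E F)"

definition annihilator_presheaf ::
  "'a topology \<Rightarrow> ('a, 'r) algebra_data \<Rightarrow> ('a, 'r, 'e) module_data \<Rightarrow> ('a, 'r, 'e) module_data
    \<Rightarrow> ('a, 'r, 'a set \<Rightarrow> 'e \<Rightarrow> 'r) module_data" where
  "annihilator_presheaf T A E F = \<lparr>
     sections = (\<lambda>U. (sections (dual T A E) U)\<lparr>carrier :=
       {t \<in> carrier (sections (dual T A E) U).
         \<forall>V. openin T V \<longrightarrow> V \<subseteq> U \<longrightarrow> (\<forall>s\<in>carrier (sections F V). t V s = \<zero>\<^bsub>sections A V\<^esub>)}\<rparr>),
     restr = restr (dual T A E)\<rparr>"

definition annihilator_sheaf ::
  "'a topology \<Rightarrow> ('a, 'r) algebra_data \<Rightarrow> ('a, 'r, 'e) module_data \<Rightarrow> ('a, 'r, 'e) module_data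
    \<Rightarrow> ('a, 'r, 'a \<Rightarrow> ('a set \<times> ('a set \<Rightarrow> 'e \<Rightarrow> 'r)) set) module_data" where
  "annihilator_sheaf T A E F = generated_sheaf T A (annihilator_presheaf T A E F)"

end

theory Submission
  imports Defs
begin

text \<open>
  A homomorphism out of \<open>E/F\<close> is the same thing as a homomorphism out of \<open>E\<close> that vanishes on \<open>F\<close>.
  Over an open set \<open>U\<close>, a homomorphism \<open>\<phi>\<close> from \<open>E/F\<close> to \<open>A\<close> is composed with the quotient morphism
  \<open>q\<close> from \<open>E\<close> to \<open>E/F\<close>. The composite \<open>t\<close> kills \<open>F\<close>, so it is a section of the annihilator presheaf
  \<open>N\<close>, and its germs form a section of the sheaf generated by \<open>N\<close>. This assignment is linear and
  compatible with restriction. It remains to see that it is bijective over each \<open>U\<close>, because the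
  inverse of a bijective morphism is again a morphism (\<open>sheaf_isomorphicI_bij_betw\<close>).

  Two properties of \<open>q\<close> are used. It is locally surjective: every section of \<open>E/F\<close> is locally of
  the form \<open>q s\<close> (\<open>quotient_map_locally_surj\<close>). And if \<open>q s = q s'\<close>, then \<open>s\<close> and \<open>s'\<close> locally differ
  by sections of \<open>F\<close> (\<open>quotient_map_eqD\<close>).

  Injectivity: if the germs of \<open>\<phi> \<circ> q\<close> and \<open>\<phi>' \<circ> q\<close> agree, then \<open>\<phi>\<close> and \<open>\<phi>'\<close> agree on every \<open>q s\<close>
  after shrinking the open set, hence locally on every section of \<open>E/F\<close>, and \<open>A\<close> is separated.

  Surjectivity: let \<open>\<sigma>\<close> be a section over \<open>U\<close> of the sheaf generated by \<open>N\<close>. Wherever \<open>\<sigma>\<close> is given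
  by a section \<open>t\<close> of \<open>N\<close> and a section \<open>\<tau>\<close> of \<open>E/F\<close> is given by a section \<open>s\<close> of \<open>E\<close>, the value of
  the preimage \<open>\<phi>\<close> at \<open>\<tau>\<close> must be \<open>t s\<close>. That value depends only on \<open>\<sigma>\<close> and \<open>\<tau>\<close>
  (\<open>annihilator_eval_well_defined\<close>) and is available locally. Since \<open>A\<close> is a sheaf, such a linear,
  locally defined prescription of values extends to a homomorphism (\<open>partial_hom_extends\<close>). The
  same gluing step takes care at once of the sheafification of the presheaf quotient and of that
  of the annihilator presheaf.
\<close>

abbreviation secs ::
  "('a, 'x, ('x, 'm) partial_object_scheme) presheaf_data \<Rightarrow> 'a set \<Rightarrow> 'x set" where
  "secs P U \<equiv> carrier (sections P U)"


section \<open>Presheaves of modules\<close>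

text \<open>
  The structure that linearity of a morphism refers to: sections closed under addition and scalar
  multiplication, both compatible with restriction. Sheaves of modules, presheaf quotients, sheaf
  Homs and generated sheaves all carry it, so the notions of morphism, germ and pullback can be
  treated for all of them in one place.
\<close>
locale module_presheaf = A: algebra_sheaf T A + P: presheaf T P
  for T :: "'a topology" and A :: "('a, 'r) algebra_data" and P :: "('a, 'r, 'e) module_data" +
  assumes add_closed:
      "\<lbrakk>openin T U; s \<in> secs P U; t \<in> secs P U\<rbrakk> \<Longrightarrow> s \<oplus>\<^bsub>sections P U\<^esub> t \<in> secs P U"
    and smult_closed:
      "\<lbrakk>openin T U; a \<in> secs A U; s \<in> secs P U\<rbrakk> \<Longrightarrow> a \<odot>\<^bsub>sections P U\<^esub> s \<in> secs P U"
    and restr_add: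
      "\<lbrakk>openin T U; openin T V; V \<subseteq> U; s \<in> secs P U; t \<in> secs P U\<rbrakk>
        \<Longrightarrow> restr P U V (s \<oplus>\<^bsub>sections P U\<^esub> t) = restr P U V s \<oplus>\<^bsub>sections P V\<^esub> restr P U V t"
    and restr_smult:
      "\<lbrakk>openin T U; openin T V; V \<subseteq> U; a \<in> secs A U; s \<in> secs P U\<rbrakk>
        \<Longrightarrow> restr P U V (a \<odot>\<^bsub>sections P U\<^esub> s) = restr A U V a \<odot>\<^bsub>sections P V\<^esub> restr P U V s"

lemma module_sheaf_imp_module_presheaf:
  assumes "module_sheaf T A E"
  shows "module_presheaf T A E"
proof -
  interpret E: module_sheaf T A E by fact
  show ?thesis
  proof
    fix U s t assume U: "openin T U" and st: "s \<in> secs E U" "t \<in> secs E U"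
    interpret M: module "sections A U" "sections E U" by (rule E.module_sections[OF U])
    from st show "s \<oplus>\<^bsub>sections E U\<^esub> t \<in> secs E U" by simp
  next
    fix U a s assume U: "openin T U" and as: "a \<in> secs A U" "s \<in> secs E U"
    interpret M: module "sections A U" "sections E U" by (rule E.module_sections[OF U])
    from as show "a \<odot>\<^bsub>sections E U\<^esub> s \<in> secs E U" by simp
  qed (simp_all add: E.restr_add E.restr_smult)
qed

sublocale module_sheaf \<subseteq> MP: module_presheaf T A E
  by (rule module_sheaf_imp_module_presheaf) (rule module_sheaf_axioms)

text \<open>
  Locality in pointwise form: instead of a cover, a neighbourhood of each point is exhibited.
\<close>
lemma (in sheaf) eq_if_locally_eq:
  assumes "openin T V" and s: "s \<in> secs F V" and t: "t \<in> secs F V"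
    and loc: "\<And>x. x \<in> V \<Longrightarrow>
      \<exists>W. openin T W \<and> x \<in> W \<and> W \<subseteq> V \<and> restr F V W s = restr F V W t"
  shows "s = t"
proof -
  define \<C> where "\<C> = {W. openin T W \<and> W \<subseteq> V \<and> restr F V W s = restr F V W t}"
  have "\<Union>\<C> = V" using loc unfolding \<C>_def by blast
  then show ?thesis
    using locality[of \<C> s t] s t unfolding \<C>_def by simp
qed

text \<open>
  A section of sheaf Hom over \<open>U\<close> is a morphism over the subspace \<open>U\<close>. Because all the structures
  restrict to open subspaces, results about morphisms over the whole space apply to these sections.
\<close>
lemma presheaf_subtopology:
  assumes "presheaf T P" and U: "openin T U"
  shows "presheaf (subtopology T U) P"
proof -
  interpret presheaf T P by fact
  show ?thesis
    by unfold_locales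
      (simp_all add: openin_open_subtopology[OF U] restr_closed restr_id restr_restr)
qed

lemma sheaf_subtopology:
  assumes "sheaf T F" and U: "openin T U"
  shows "sheaf (subtopology T U) F"
proof -
  interpret sheaf T F by fact
  show ?thesis
  proof (intro sheaf.intro presheaf_subtopology sheaf_axioms.intro)
    show "presheaf T F" ..
    show "\<And>\<C> \<sigma>. \<lbrakk>\<forall>V\<in>\<C>. openin (subtopology T U) V; \<forall>V\<in>\<C>. \<sigma> V \<in> secs F V;
        \<forall>V\<in>\<C>. \<forall>W\<in>\<C>. restr F V (V \<inter> W) (\<sigma> V) = restr F W (V \<inter> W) (\<sigma> W)\<rbrakk>
        \<Longrightarrow> \<exists>s\<in>secs F (\<Union>\<C>). \<forall>V\<in>\<C>. restr F (\<Union>\<C>) V s = \<sigma> V"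
      by (rule gluing) (simp_all add: openin_open_subtopology[OF U])
    show "\<And>\<C> s t. \<lbrakk>\<forall>V\<in>\<C>. openin (subtopology T U) V; s \<in> secs F (\<Union>\<C>); t \<in> secs F (\<Union>\<C>);
        \<forall>V\<in>\<C>. restr F (\<Union>\<C>) V s = restr F (\<Union>\<C>) V t\<rbrakk> \<Longrightarrow> s = t"
      by (rule locality) (simp_all add: openin_open_subtopology[OF U])
  qed (rule U)
qed

lemma algebra_sheaf_subtopology:
  assumes "algebra_sheaf T A" and U: "openin T U"
  shows "algebra_sheaf (subtopology T U) A"
proof -
  interpret algebra_sheaf T A by fact
  show ?thesis
    by (intro algebra_sheaf.intro sheaf_subtopology algebra_sheaf_axioms.intro)
      (simp_all add: U sheaf_axioms openin_open_subtopology[OF U] algebra_sections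
        restr_ring_hom restr_scalar)
qed

lemma module_presheaf_subtopology:
  assumes "module_presheaf T A P" and U: "openin T U"
  shows "module_presheaf (subtopology T U) A P"
proof -
  interpret module_presheaf T A P by fact
  show ?thesis
    by (intro module_presheaf.intro algebra_sheaf_subtopology presheaf_subtopology
        module_presheaf_axioms.intro)
      (simp_all add: U A.algebra_sheaf_axioms P.presheaf_axioms openin_open_subtopology[OF U]
        add_closed smult_closed restr_add restr_smult)
qed

lemma module_sheaf_subtopology:
  assumes "module_sheaf T A G" and U: "openin T U"
  shows "module_sheaf (subtopology T U) A G"
proof -
  interpret module_sheaf T A G by fact
  show ?thesis
    by (intro module_sheaf.intro algebra_sheaf_subtopology sheaf_subtopology
        module_sheaf_axioms.intro)
      (simp_all add: U A.algebra_sheaf_axioms E.sheaf_axioms openin_open_subtopology[OF U]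
        module_sections restr_add restr_smult)
qed

lemma (in algebra_sheaf) cring_sections: "openin T U \<Longrightarrow> cring (sections A U)"
  using algebra_sections algebra.M_cring by blast

lemma (in algebra_sheaf) module_sheaf_structure_module: "module_sheaf T A (structure_module A)"
proof -
  have sheaf: "sheaf T (structure_module A)"
  proof unfold_locales
    show "\<And>\<C> \<sigma>. \<lbrakk>\<forall>V\<in>\<C>. openin T V; \<forall>V\<in>\<C>. \<sigma> V \<in> secs (structure_module A) V;
        \<forall>V\<in>\<C>. \<forall>W\<in>\<C>. restr (structure_module A) V (V \<inter> W) (\<sigma> V)
          = restr (structure_module A) W (V \<inter> W) (\<sigma> W)\<rbrakk>
        \<Longrightarrow> \<exists>s\<in>secs (structure_module A) (\<Union>\<C>).
          \<forall>V\<in>\<C>. restr (structure_module A) (\<Union>\<C>) V s = \<sigma> V"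
      using gluing by (simp add: structure_module_def)
    show "\<And>\<C> s t. \<lbrakk>\<forall>V\<in>\<C>. openin T V; s \<in> secs (structure_module A) (\<Union>\<C>);
        t \<in> secs (structure_module A) (\<Union>\<C>);
        \<forall>V\<in>\<C>. restr (structure_module A) (\<Union>\<C>) V s = restr (structure_module A) (\<Union>\<C>) V t\<rbrakk>
        \<Longrightarrow> s = t"
      using locality by (simp add: structure_module_def)
  qed (simp_all add: structure_module_def restr_closed restr_id restr_restr)
  show ?thesis
  proof (intro module_sheaf.intro module_sheaf_axioms.intro)
    show "algebra_sheaf T A" ..
    show "sheaf T (structure_module A)" by (rule sheaf)
  next
    fix U assume U: "openin T U"
    interpret R: cring "sections A U" by (rule cring_sections[OF U])
    show "module (sections A U) (sections (structure_module A) U)"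
    proof (rule moduleI)
      show "abelian_group (sections (structure_module A) U)"
        unfolding structure_module_def
        by (rule abelian_groupI) (auto simp: R.a_ac R.l_neg intro: R.l_neg)
    qed (auto simp: structure_module_def R.l_distr R.r_distr R.m_assoc R.is_cring)
  next
    fix U V s t
    assume "openin T U" "openin T V" "V \<subseteq> U" "s \<in> secs (structure_module A) U"
      "t \<in> secs (structure_module A) U"
    then show "restr (structure_module A) U V (s \<oplus>\<^bsub>sections (structure_module A) U\<^esub> t) =
        restr (structure_module A) U V s \<oplus>\<^bsub>sections (structure_module A) V\<^esub>
        restr (structure_module A) U V t"
      using ring_hom_add[OF restr_ring_hom] by (simp add: structure_module_def)
  next
    fix U V a s
    assume "openin T U" "openin T V" "V \<subseteq> U" "a \<in> secs A U" "s \<in> secs (structure_module A) U"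
    then show "restr (structure_module A) U V (a \<odot>\<^bsub>sections (structure_module A) U\<^esub> s) =
        restr A U V a \<odot>\<^bsub>sections (structure_module A) V\<^esub> restr (structure_module A) U V s"
      using ring_hom_mult[OF restr_ring_hom] by (simp add: structure_module_def)
  qed
qed


section \<open>Morphisms\<close>

lemma sheaf_homsI:
  assumes "\<And>U. \<not> openin T U \<Longrightarrow> \<phi> U = undefined"
    and "\<And>U s. \<lbrakk>openin T U; s \<notin> secs M U\<rbrakk> \<Longrightarrow> \<phi> U s = undefined"
    and "\<And>U s. \<lbrakk>openin T U; s \<in> secs M U\<rbrakk> \<Longrightarrow> \<phi> U s \<in> secs G U"
    and "\<And>U s t. \<lbrakk>openin T U; s \<in> secs M U; t \<in> secs M U\<rbrakk>
      \<Longrightarrow> \<phi> U (s \<oplus>\<^bsub>sections M U\<^esub> t) = \<phi> U s \<oplus>\<^bsub>sections G U\<^esub> \<phi> U t"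
    and "\<And>U a s. \<lbrakk>openin T U; a \<in> secs A U; s \<in> secs M U\<rbrakk>
      \<Longrightarrow> \<phi> U (a \<odot>\<^bsub>sections M U\<^esub> s) = a \<odot>\<^bsub>sections G U\<^esub> \<phi> U s"
    and "\<And>U V s. \<lbrakk>openin T U; openin T V; V \<subseteq> U; s \<in> secs M U\<rbrakk>
      \<Longrightarrow> \<phi> V (restr M U V s) = restr G U V (\<phi> U s)"
  shows "\<phi> \<in> sheaf_homs T A M G"
  using assms unfolding sheaf_homs_def linear_maps_def by (auto simp: PiE_iff extensional_def)

lemma sheaf_homsD:
  assumes "\<phi> \<in> sheaf_homs T A M G"
  shows sheaf_hom_undefined: "\<And>U. \<not> openin T U \<Longrightarrow> \<phi> U = undefined"
    and sheaf_hom_undefined': "\<And>U s. \<lbrakk>openin T U; s \<notin> secs M U\<rbrakk> \<Longrightarrow> \<phi> U s = undefined"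
    and sheaf_hom_closed: "\<And>U s. \<lbrakk>openin T U; s \<in> secs M U\<rbrakk> \<Longrightarrow> \<phi> U s \<in> secs G U"
    and sheaf_hom_add: "\<And>U s t. \<lbrakk>openin T U; s \<in> secs M U; t \<in> secs M U\<rbrakk>
      \<Longrightarrow> \<phi> U (s \<oplus>\<^bsub>sections M U\<^esub> t) = \<phi> U s \<oplus>\<^bsub>sections G U\<^esub> \<phi> U t"
    and sheaf_hom_smult: "\<And>U a s. \<lbrakk>openin T U; a \<in> secs A U; s \<in> secs M U\<rbrakk>
      \<Longrightarrow> \<phi> U (a \<odot>\<^bsub>sections M U\<^esub> s) = a \<odot>\<^bsub>sections G U\<^esub> \<phi> U s"
    and sheaf_hom_restr: "\<And>U V s. \<lbrakk>openin T U; openin T V; V \<subseteq> U; s \<in> secs M U\<rbrakk>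
      \<Longrightarrow> \<phi> V (restr M U V s) = restr G U V (\<phi> U s)"
  using assms unfolding sheaf_homs_def linear_maps_def by (auto simp: PiE_iff extensional_def)

lemma sheaf_hom_eqI:
  assumes "\<phi> \<in> sheaf_homs T A M G" "\<psi> \<in> sheaf_homs T A M G"
    and "\<And>U s. \<lbrakk>openin T U; s \<in> secs M U\<rbrakk> \<Longrightarrow> \<phi> U s = \<psi> U s"
  shows "\<phi> = \<psi>"
proof (intro ext)
  fix U s
  show "\<phi> U s = \<psi> U s"
    using assms(3)[of U s] sheaf_homsD(1,2)[OF assms(1)] sheaf_homsD(1,2)[OF assms(2)]
    by (cases "openin T U"; cases "s \<in> secs M U") auto
qed

definition hom_comp ::
  "'a topology \<Rightarrow> ('a, 'r, 'e) module_data \<Rightarrow> ('a set \<Rightarrow> 'f \<Rightarrow> 'g) \<Rightarrow> ('a set \<Rightarrow> 'e \<Rightarrow> 'f)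
    \<Rightarrow> ('a set \<Rightarrow> 'e \<Rightarrow> 'g)" where
  "hom_comp T M \<psi> \<phi> = (\<lambda>U\<in>{U. openin T U}. compose (secs M U) (\<psi> U) (\<phi> U))"

lemma hom_comp_apply:
  "\<lbrakk>openin T U; s \<in> secs M U\<rbrakk> \<Longrightarrow> hom_comp T M \<psi> \<phi> U s = \<psi> U (\<phi> U s)"
  by (simp add: hom_comp_def compose_def)

lemma hom_comp_in_sheaf_homs:
  assumes "module_presheaf T A M"
    and \<phi>: "\<phi> \<in> sheaf_homs T A M N" and \<psi>: "\<psi> \<in> sheaf_homs T A N G"
  shows "hom_comp T M \<psi> \<phi> \<in> sheaf_homs T A M G"
proof -
  interpret M: module_presheaf T A M by fact
  note D = sheaf_homsD(3-6)[OF \<phi>] sheaf_homsD(3-6)[OF \<psi>]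
  show ?thesis
  proof (rule sheaf_homsI)
    show "hom_comp T M \<psi> \<phi> U = undefined" if "\<not> openin T U" for U
      using that by (simp add: hom_comp_def)
    show "hom_comp T M \<psi> \<phi> U s = undefined" if "openin T U" "s \<notin> secs M U" for U s
      using that by (simp add: hom_comp_def compose_def)
  qed (simp_all add: hom_comp_apply M.add_closed M.smult_closed M.P.restr_closed D)
qed

lemma restrict_in_sheaf_homs:
  assumes "\<phi> \<in> sheaf_homs T A M G" and sub: "\<And>V. openin S V \<Longrightarrow> openin T V"
  shows "restrict \<phi> {V. openin S V} \<in> sheaf_homs S A M G"
  using sheaf_homsD[OF assms(1)] by (intro sheaf_homsI) (auto dest!: sub)

text \<open>
  Linearity and naturality of the inverse are read off on preimages, since closure of the source
  under the operations makes the sum of two preimages a preimage of the sum.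
\<close>
lemma sheaf_isomorphicI_bij_betw:
  assumes "module_presheaf T A M" and \<phi>: "\<phi> \<in> sheaf_homs T A M G"
    and bij: "\<And>U. openin T U \<Longrightarrow> bij_betw (\<phi> U) (secs M U) (secs G U)"
  shows "sheaf_isomorphic T A M G"
proof -
  interpret M: module_presheaf T A M by fact
  note D = sheaf_homsD(3-6)[OF \<phi>]
  define \<psi> where
    "\<psi> = (\<lambda>U\<in>{U. openin T U}. \<lambda>t\<in>secs G U. the_inv_into (secs M U) (\<phi> U) t)"
  have \<psi>\<phi>: "\<psi> U (\<phi> U s) = s" if "openin T U" "s \<in> secs M U" for U s
    using bij[OF that(1)] that D(1)[OF that] unfolding \<psi>_def
    by (simp add: the_inv_into_f_f bij_betw_def)
  have preimage: "\<exists>s\<in>secs M U. t = \<phi> U s" if "openin T U" "t \<in> secs G U" for U t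
    using bij[OF that(1)] that unfolding bij_betw_def by blast
  have "\<psi> \<in> sheaf_homs T A G M"
  proof (rule sheaf_homsI)
    show "\<psi> U = undefined" if "\<not> openin T U" for U using that by (simp add: \<psi>_def)
    show "\<psi> U s = undefined" if "openin T U" "s \<notin> secs G U" for U s
      using that by (simp add: \<psi>_def)
    show "\<psi> U t \<in> secs M U" if "openin T U" "t \<in> secs G U" for U t
      using preimage[OF that] \<psi>\<phi> that by auto
    show "\<psi> U (t \<oplus>\<^bsub>sections G U\<^esub> t') = \<psi> U t \<oplus>\<^bsub>sections M U\<^esub> \<psi> U t'"
      if U: "openin T U" and t: "t \<in> secs G U" "t' \<in> secs G U" for U t t'
    proof -
      obtain s s' where "s \<in> secs M U" "t = \<phi> U s" "s' \<in> secs M U" "t' = \<phi> U s'"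
        using preimage[OF U t(1)] preimage[OF U t(2)] by blast
      then show ?thesis by (simp add: U D(2)[symmetric] \<psi>\<phi> M.add_closed)
    qed
    show "\<psi> U (a \<odot>\<^bsub>sections G U\<^esub> t) = a \<odot>\<^bsub>sections M U\<^esub> \<psi> U t"
      if U: "openin T U" and a: "a \<in> secs A U" and t: "t \<in> secs G U" for U a t
    proof -
      obtain s where "s \<in> secs M U" "t = \<phi> U s" using preimage[OF U t] by blast
      then show ?thesis by (simp add: U a D(3)[symmetric] \<psi>\<phi> M.smult_closed)
    qed
    show "\<psi> V (restr G U V t) = restr M U V (\<psi> U t)"
      if U: "openin T U" and V: "openin T V" "V \<subseteq> U" and t: "t \<in> secs G U" for U V t
    proof -
      obtain s where "s \<in> secs M U" "t = \<phi> U s" using preimage[OF U t] by blast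
      then show ?thesis by (simp add: U V D(4)[symmetric] \<psi>\<phi> M.P.restr_closed)
    qed
  qed
  moreover have "\<phi> U (\<psi> U t) = t" if "openin T U" "t \<in> secs G U" for U t
    using preimage[OF that] \<psi>\<phi>[OF that(1)] by auto
  ultimately show ?thesis
    unfolding sheaf_isomorphic_def using \<phi> \<psi>\<phi> by blast
qed


section \<open>Gluing of locally defined homomorphisms\<close>

text \<open>
  The gluing principle for homomorphisms. The relation \<open>L W s a\<close> prescribes the value \<open>a\<close> at the
  section \<open>s\<close> over \<open>W\<close>. If the prescription is single-valued, stable under restriction, linear, and
  defined after shrinking the open set around any point, then it extends to a homomorphism: the
  prescribed local values of a section agree on overlaps, so they glue in the sheaf \<open>G\<close>.
\<close>
lemma partial_hom_extends:
  assumes "module_presheaf T A M" and "module_sheaf T A G"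
    and dom: "\<And>W s a. \<lbrakk>openin T W; s \<in> secs M W; L W s a\<rbrakk> \<Longrightarrow> a \<in> secs G W"
    and functional: "\<And>W s a b. \<lbrakk>openin T W; s \<in> secs M W; L W s a; L W s b\<rbrakk> \<Longrightarrow> a = b"
    and restr: "\<And>W W' s a. \<lbrakk>openin T W; openin T W'; W' \<subseteq> W; s \<in> secs M W; L W s a\<rbrakk>
      \<Longrightarrow> L W' (restr M W W' s) (restr G W W' a)"
    and local: "\<And>V s x. \<lbrakk>openin T V; s \<in> secs M V; x \<in> V\<rbrakk>
      \<Longrightarrow> \<exists>W a. openin T W \<and> x \<in> W \<and> W \<subseteq> V \<and> L W (restr M V W s) a"
    and add: "\<And>W s t a b. \<lbrakk>openin T W; s \<in> secs M W; t \<in> secs M W; L W s a; L W t b\<rbrakk>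
      \<Longrightarrow> L W (s \<oplus>\<^bsub>sections M W\<^esub> t) (a \<oplus>\<^bsub>sections G W\<^esub> b)"
    and smult: "\<And>W c s a. \<lbrakk>openin T W; c \<in> secs A W; s \<in> secs M W; L W s a\<rbrakk>
      \<Longrightarrow> L W (c \<odot>\<^bsub>sections M W\<^esub> s) (c \<odot>\<^bsub>sections G W\<^esub> a)"
  obtains \<phi> where "\<phi> \<in> sheaf_homs T A M G"
    and "\<And>W s a. \<lbrakk>openin T W; s \<in> secs M W; L W s a\<rbrakk> \<Longrightarrow> \<phi> W s = a"
proof -
  interpret M: module_presheaf T A M by fact
  interpret G: module_sheaf T A G by fact
  \<comment> \<open>\<open>val V s a\<close>: the section \<open>a\<close> has the prescribed values at \<open>s\<close> in small neighbourhoods. Unlike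
    \<open>L\<close> this determines a value for every \<open>s\<close>, and it is still closed under the operations because
    two sections can be tested on a common neighbourhood.\<close>
  define val where "val V s a \<longleftrightarrow> a \<in> secs G V \<and> (\<forall>x\<in>V. \<exists>W. openin T W \<and> x \<in> W \<and> W \<subseteq> V \<and>
      L W (restr M V W s) (restr G V W a))" for V s a
  have val_closed: "a \<in> secs G V" if "val V s a" for V s a
    using that unfolding val_def by blast
  have val_L: "val W s a" if "openin T W" "s \<in> secs M W" "L W s a" for W s a
    using that dom[OF that] M.P.restr_id G.E.restr_id unfolding val_def by auto
  have val_common: "\<exists>W. openin T W \<and> x \<in> W \<and> W \<subseteq> V \<and> L W (restr M V W s) (restr G V W a) \<and>
      L W (restr M V W t) (restr G V W b)"
    if V: "openin T V" and s: "s \<in> secs M V" and t: "t \<in> secs M V"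
      and a: "val V s a" and b: "val V t b" and x: "x \<in> V" for V s t a b x
  proof -
    obtain W where W: "openin T W" "x \<in> W" "W \<subseteq> V" "L W (restr M V W s) (restr G V W a)"
      using a x unfolding val_def by blast
    obtain W' where W': "openin T W'" "x \<in> W'" "W' \<subseteq> V" "L W' (restr M V W' t) (restr G V W' b)"
      using b x unfolding val_def by blast
    have I: "openin T (W \<inter> W')" using W W' by blast
    have "L (W \<inter> W') (restr M V (W \<inter> W') s) (restr G V (W \<inter> W') a)"
      using restr[OF W(1) I _ _ W(4)] V I W s M.P.restr_closed M.P.restr_restr
        G.E.restr_restr val_closed[OF a] by simp
    moreover have "L (W \<inter> W') (restr M V (W \<inter> W') t) (restr G V (W \<inter> W') b)"
      using restr[OF W'(1) I _ _ W'(4)] V I W' t M.P.restr_closed M.P.restr_restr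
        G.E.restr_restr val_closed[OF b] by simp
    ultimately show ?thesis using I W W' by blast
  qed
  have val_unique: "a = b" if V: "openin T V" and s: "s \<in> secs M V" and a: "val V s a"
    and b: "val V s b" for V s a b
  proof (rule G.E.eq_if_locally_eq[OF V val_closed[OF a] val_closed[OF b]])
    fix x assume "x \<in> V"
    then obtain W where W: "openin T W" "x \<in> W" "W \<subseteq> V"
      and L: "L W (restr M V W s) (restr G V W a)" "L W (restr M V W s) (restr G V W b)"
      using val_common[OF V s s a b] by blast
    from functional[OF W(1) M.P.restr_closed[OF V W(1,3) s] L] W
    show "\<exists>W. openin T W \<and> x \<in> W \<and> W \<subseteq> V \<and> restr G V W a = restr G V W b"
      by blast
  qed
  have val_exists: "\<exists>a. val V s a" if V: "openin T V" and s: "s \<in> secs M V" for V s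
  proof -
    define \<C> where "\<C> = {W. openin T W \<and> W \<subseteq> V \<and> (\<exists>a. L W (restr M V W s) a)}"
    define \<beta> where "\<beta> W = (SOME a. L W (restr M V W s) a)" for W
    have \<beta>: "L W (restr M V W s) (\<beta> W)" if "W \<in> \<C>" for W
      using that someI_ex[of "L W (restr M V W s)"] unfolding \<C>_def \<beta>_def by blast
    have C: "openin T W" "W \<subseteq> V" "restr M V W s \<in> secs M W" if "W \<in> \<C>" for W
      using that M.P.restr_closed[OF V _ _ s] unfolding \<C>_def by auto
    have cover: "\<Union>\<C> = V" using local[OF V s] unfolding \<C>_def by blast
    have \<beta>_restr: "L W' (restr M V W' s) (restr G W W' (\<beta> W))"
      if "W \<in> \<C>" "openin T W'" "W' \<subseteq> W" for W W'
      using restr[OF C(1)[OF that(1)] that(2,3) C(3)[OF that(1)] \<beta>[OF that(1)]]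
        C[OF that(1)] that M.P.restr_restr[OF V _ _ _ _ s] by simp
    have "\<exists>a\<in>secs G (\<Union>\<C>). \<forall>W\<in>\<C>. restr G (\<Union>\<C>) W a = \<beta> W"
    proof (rule G.E.gluing)
      show "\<forall>W\<in>\<C>. openin T W" using C by blast
      show "\<forall>W\<in>\<C>. \<beta> W \<in> secs G W" using C \<beta> dom by blast
      show "\<forall>W\<in>\<C>. \<forall>W'\<in>\<C>. restr G W (W \<inter> W') (\<beta> W) = restr G W' (W \<inter> W') (\<beta> W')"
      proof (intro ballI)
        fix W W' assume W: "W \<in> \<C>" "W' \<in> \<C>"
        have I: "openin T (W \<inter> W')" "W \<inter> W' \<subseteq> V" using C W by blast+
        show "restr G W (W \<inter> W') (\<beta> W) = restr G W' (W \<inter> W') (\<beta> W')"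
          by (rule functional[OF I(1) M.P.restr_closed[OF V I s]])
            (simp_all add: \<beta>_restr W I)
      qed
    qed
    then obtain a where a: "a \<in> secs G V" "\<And>W. W \<in> \<C> \<Longrightarrow> restr G V W a = \<beta> W"
      unfolding cover by blast
    have "val V s a"
      unfolding val_def
    proof (intro conjI ballI)
      fix x assume "x \<in> V"
      then obtain W where "W \<in> \<C>" "x \<in> W" using cover by blast
      then show "\<exists>W. openin T W \<and> x \<in> W \<and> W \<subseteq> V \<and> L W (restr M V W s) (restr G V W a)"
        using C \<beta> a(2) by (intro exI[of _ W]) simp
    qed (rule a(1))
    then show ?thesis ..
  qed
  define \<phi> where "\<phi> = (\<lambda>V\<in>{V. openin T V}. \<lambda>s\<in>secs M V. THE a. val V s a)"
  have \<phi>_eq: "\<phi> V s = a" if "openin T V" "s \<in> secs M V" "val V s a" for V s a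
    using that val_unique unfolding \<phi>_def by (auto intro!: the_equality)
  have \<phi>_val: "val V s (\<phi> V s)" if "openin T V" "s \<in> secs M V" for V s
    using val_exists[OF that] \<phi>_eq[OF that] by auto
  have "\<phi> \<in> sheaf_homs T A M G"
  proof (rule sheaf_homsI)
    show "\<phi> U = undefined" if "\<not> openin T U" for U using that by (simp add: \<phi>_def)
    show "\<phi> U s = undefined" if "openin T U" "s \<notin> secs M U" for U s
      using that by (simp add: \<phi>_def)
    show "\<phi> U s \<in> secs G U" if "openin T U" "s \<in> secs M U" for U s
      using \<phi>_val[OF that] val_closed by blast
    show "\<phi> U (s \<oplus>\<^bsub>sections M U\<^esub> t) = \<phi> U s \<oplus>\<^bsub>sections G U\<^esub> \<phi> U t"
      if U: "openin T U" and s: "s \<in> secs M U" and t: "t \<in> secs M U" for U s t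
    proof (rule \<phi>_eq[OF U M.add_closed[OF U s t]])
      note vs = \<phi>_val[OF U s] and vt = \<phi>_val[OF U t]
      note cl = val_closed[OF vs] val_closed[OF vt]
      have "\<exists>W. openin T W \<and> x \<in> W \<and> W \<subseteq> U \<and> L W (restr M U W (s \<oplus>\<^bsub>sections M U\<^esub> t))
          (restr G U W (\<phi> U s \<oplus>\<^bsub>sections G U\<^esub> \<phi> U t))" if x: "x \<in> U" for x
      proof -
        obtain W where W: "openin T W" "x \<in> W" "W \<subseteq> U"
          "L W (restr M U W s) (restr G U W (\<phi> U s))" "L W (restr M U W t) (restr G U W (\<phi> U t))"
          using val_common[OF U s t vs vt x] by blast
        show ?thesis
          using W add[OF W(1) _ _ W(4,5)] M.P.restr_closed[OF U W(1,3)] s t cl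
          by (auto simp: M.restr_add[OF U W(1,3)] G.restr_add[OF U W(1,3)])
      qed
      then show "val U (s \<oplus>\<^bsub>sections M U\<^esub> t) (\<phi> U s \<oplus>\<^bsub>sections G U\<^esub> \<phi> U t)"
        unfolding val_def using G.MP.add_closed[OF U cl] by blast
    qed
    show "\<phi> U (c \<odot>\<^bsub>sections M U\<^esub> s) = c \<odot>\<^bsub>sections G U\<^esub> \<phi> U s"
      if U: "openin T U" and c: "c \<in> secs A U" and s: "s \<in> secs M U" for U c s
    proof (rule \<phi>_eq[OF U M.smult_closed[OF U c s]])
      note vs = \<phi>_val[OF U s]
      note cl = val_closed[OF vs]
      have "\<exists>W. openin T W \<and> x \<in> W \<and> W \<subseteq> U \<and> L W (restr M U W (c \<odot>\<^bsub>sections M U\<^esub> s))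
          (restr G U W (c \<odot>\<^bsub>sections G U\<^esub> \<phi> U s))" if x: "x \<in> U" for x
      proof -
        obtain W where W: "openin T W" "x \<in> W" "W \<subseteq> U"
          "L W (restr M U W s) (restr G U W (\<phi> U s))"
          using vs x unfolding val_def by blast
        show ?thesis
          using W smult[OF W(1) _ _ W(4)] M.P.restr_closed[OF U W(1,3)]
            M.A.restr_closed[OF U W(1,3)] c s cl
          by (auto simp: M.restr_smult[OF U W(1,3)] G.restr_smult[OF U W(1,3)])
      qed
      then show "val U (c \<odot>\<^bsub>sections M U\<^esub> s) (c \<odot>\<^bsub>sections G U\<^esub> \<phi> U s)"
        unfolding val_def using G.MP.smult_closed[OF U c cl] by blast
    qed
    show "\<phi> V (restr M U V s) = restr G U V (\<phi> U s)"
      if U: "openin T U" and V: "openin T V" "V \<subseteq> U" and s: "s \<in> secs M U" for U V s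
    proof (rule \<phi>_eq[OF V(1) M.P.restr_closed[OF U V s]])
      note vs = \<phi>_val[OF U s]
      note cl = val_closed[OF vs]
      have "\<exists>W. openin T W \<and> x \<in> W \<and> W \<subseteq> V \<and>
          L W (restr M V W (restr M U V s)) (restr G V W (restr G U V (\<phi> U s)))"
        if x: "x \<in> V" for x
      proof -
        obtain W where W: "openin T W" "x \<in> W" "W \<subseteq> U"
          "L W (restr M U W s) (restr G U W (\<phi> U s))"
          using vs x V unfolding val_def by blast
        have I: "openin T (W \<inter> V)" using W V by blast
        show ?thesis
          using restr[OF W(1) I _ _ W(4)] M.P.restr_closed[OF U W(1,3) s] W V I x s cl U
          by (intro exI[of _ "W \<inter> V"]) (simp add: M.P.restr_restr G.E.restr_restr)
      qed
      then show "val V (restr M U V s) (restr G U V (\<phi> U s))"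
        unfolding val_def using G.E.restr_closed[OF U V cl] by blast
    qed
  qed
  then show ?thesis using that \<phi>_eq val_L by blast
qed


section \<open>Sheaf Hom and pullback along a morphism\<close>

lemma sum_in_sheaf_homs:
  assumes "module_presheaf T A M" and "module_sheaf T A G"
    and \<phi>: "\<phi> \<in> sheaf_homs T A M G" and \<psi>: "\<psi> \<in> sheaf_homs T A M G"
  shows "(\<lambda>V\<in>{V. openin T V}. \<lambda>s\<in>secs M V. \<phi> V s \<oplus>\<^bsub>sections G V\<^esub> \<psi> V s) \<in> sheaf_homs T A M G"
proof -
  interpret M: module_presheaf T A M by fact
  interpret G: module_sheaf T A G by fact
  note D = sheaf_homsD(3-6)[OF \<phi>] sheaf_homsD(3-6)[OF \<psi>]
  show ?thesis
  proof (rule sheaf_homsI, goal_cases)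
    case (4 U s t)
    interpret GU: module "sections A U" "sections G U" by (rule G.module_sections) fact
    from 4 show ?case by (simp add: D M.add_closed GU.M.a_ac)
  next
    case (5 U a s)
    interpret GU: module "sections A U" "sections G U" by (rule G.module_sections) fact
    from 5 show ?case by (simp add: D M.smult_closed GU.smult_r_distr)
  qed (simp_all add: D M.P.restr_closed G.MP.add_closed G.restr_add)
qed

text \<open>
  Scalars act on sheaf Hom through global sections of the algebra on the subspace, so here the
  scalar \<open>c\<close> is a section over the whole space. Commutativity of the algebra makes \<open>c\<close> times \<open>\<phi>\<close>
  linear.
\<close>
lemma multiple_in_sheaf_homs:
  assumes "module_presheaf T A M" and "module_sheaf T A G"
    and \<phi>: "\<phi> \<in> sheaf_homs T A M G" and c: "c \<in> secs A (topspace T)"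
  shows "(\<lambda>V\<in>{V. openin T V}. \<lambda>s\<in>secs M V. restr A (topspace T) V c \<odot>\<^bsub>sections G V\<^esub> \<phi> V s)
    \<in> sheaf_homs T A M G"
proof -
  interpret M: module_presheaf T A M by fact
  interpret G: module_sheaf T A G by fact
  note D = sheaf_homsD(3-6)[OF \<phi>]
  have cl: "restr A (topspace T) U c \<in> secs A U" if "openin T U" for U
    by (rule M.A.restr_closed) (simp_all add: that c openin_subset)
  show ?thesis
  proof (rule sheaf_homsI, goal_cases)
    case (4 U s t)
    interpret GU: module "sections A U" "sections G U" by (rule G.module_sections) fact
    from 4 show ?case by (simp add: D M.add_closed GU.smult_r_distr cl)
  next
    case (5 U a s)
    interpret GU: module "sections A U" "sections G U" by (rule G.module_sections) fact
    from 5 show ?case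
      by (simp add: D M.smult_closed cl GU.smult_assoc1[symmetric] GU.R.m_comm)
  next
    case (6 U V s)
    from 6 show ?case
      by (simp add: D M.P.restr_closed cl G.restr_smult M.A.restr_restr c openin_subset)
  qed (simp_all add: D cl G.MP.smult_closed)
qed

lemma hom_sheaf_module_presheaf:
  assumes M: "module_presheaf T A M" and G: "module_sheaf T A G"
  shows "module_presheaf T A (hom_sheaf T A M G)"
proof -
  interpret M: module_presheaf T A M by fact
  interpret G: module_sheaf T A G by fact
  show ?thesis
  proof (intro module_presheaf.intro presheaf.intro module_presheaf_axioms.intro, goal_cases)
    case 1
    show ?case ..
  next
    case (2 U V \<phi>)
    then have "openin (subtopology T U) W" if "openin (subtopology T V) W" for W
      using that by (auto simp: openin_open_subtopology)
    with 2 show ?case by (simp add: hom_sheaf_def restrict_in_sheaf_homs)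
  next
    case (3 U \<phi>)
    then have "\<phi> \<in> sheaf_homs (subtopology T U) A M G" by (simp add: hom_sheaf_def)
    from sheaf_homsD(1)[OF this] show ?case by (auto simp: hom_sheaf_def restrict_def)
  next
    case (4 U V W \<phi>)
    then show ?case
      by (auto simp: hom_sheaf_def openin_open_subtopology restrict_def fun_eq_iff)
  next
    case (5 U \<phi> \<psi>)
    then show ?case
      using sum_in_sheaf_homs[OF module_presheaf_subtopology[OF M] module_sheaf_subtopology[OF G]]
      by (simp add: hom_sheaf_def)
  next
    case (6 U a \<phi>)
    then have "topspace (subtopology T U) = U" by (simp add: openin_subset inf.absorb2)
    then show ?case
      using 6 multiple_in_sheaf_homs[OF module_presheaf_subtopology[OF M]
          module_sheaf_subtopology[OF G], of U \<phi> a]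
      by (simp add: hom_sheaf_def)
  next
    case (7 U V \<phi> \<psi>)
    then show ?case
      by (auto simp: hom_sheaf_def openin_open_subtopology restrict_def fun_eq_iff)
  next
    case (8 U V a \<phi>)
    then show ?case
      by (auto simp: hom_sheaf_def openin_open_subtopology restrict_def fun_eq_iff
          M.A.restr_restr)
  qed
qed

definition hom_pullback ::
  "'a topology \<Rightarrow> ('a, 'r) algebra_data \<Rightarrow> ('a, 'r, 'e) module_data \<Rightarrow> ('a, 'r, 'f) module_data
    \<Rightarrow> ('a, 'r, 'g) module_data \<Rightarrow> ('a set \<Rightarrow> 'e \<Rightarrow> 'f)
    \<Rightarrow> ('a set \<Rightarrow> ('a set \<Rightarrow> 'f \<Rightarrow> 'g) \<Rightarrow> 'a set \<Rightarrow> 'e \<Rightarrow> 'g)" where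
  "hom_pullback T A M Q G q = (\<lambda>U\<in>{U. openin T U}. \<lambda>\<phi>\<in>sheaf_homs (subtopology T U) A Q G.
     hom_comp (subtopology T U) M \<phi> q)"

lemma hom_pullback_apply:
  assumes "openin T U" "\<phi> \<in> sheaf_homs (subtopology T U) A Q G"
    and "openin T V" "V \<subseteq> U" "s \<in> secs M V"
  shows "hom_pullback T A M Q G q U \<phi> V s = \<phi> V (q V s)"
  using assms by (simp add: hom_pullback_def hom_comp_apply openin_open_subtopology)

lemma hom_pullback_in_sheaf_homs:
  assumes M: "module_presheaf T A M" and Q: "module_presheaf T A Q" and G: "module_sheaf T A G"
    and q: "q \<in> sheaf_homs T A M Q"
  shows "hom_pullback T A M Q G q \<in> sheaf_homs T A (hom_sheaf T A Q G) (hom_sheaf T A M G)"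
proof -
  interpret H: module_presheaf T A "hom_sheaf T A Q G"
    by (rule hom_sheaf_module_presheaf[OF Q G])
  have secs_H: "secs (hom_sheaf T A N G) U = sheaf_homs (subtopology T U) A N G"
    for U and N :: "('a, 'b, 'h) module_data"
    by (simp add: hom_sheaf_def)
  note qD = sheaf_homsD(3)[OF q]
  show ?thesis
  proof (rule sheaf_homsI, goal_cases)
    case (3 U \<phi>)
    let ?S = "subtopology T U"
    \<comment> \<open>Over the subspace \<open>U\<close>, precomposition with \<open>q\<close> is precomposition with the restriction of \<open>q\<close>.\<close>
    have "restrict q {V. openin ?S V} \<in> sheaf_homs ?S A M Q"
      by (rule restrict_in_sheaf_homs[OF q]) (use 3 in \<open>simp add: openin_open_subtopology\<close>)
    moreover have "hom_comp ?S M \<phi> (restrict q {V. openin ?S V}) = hom_comp ?S M \<phi> q"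
      by (auto simp: hom_comp_def restrict_def fun_eq_iff compose_def)
    moreover have "\<phi> \<in> sheaf_homs ?S A Q G" using 3 by (simp add: hom_sheaf_def)
    ultimately have "hom_comp ?S M \<phi> q \<in> sheaf_homs ?S A M G"
      using hom_comp_in_sheaf_homs[OF module_presheaf_subtopology[OF M 3(1)]] by metis
    then show ?case using 3 by (simp add: hom_pullback_def secs_H hom_sheaf_def)
  next
    case (4 U \<phi> \<psi>)
    then show ?case
      using H.add_closed[OF 4]
      by (auto simp: hom_pullback_def hom_sheaf_def hom_comp_def compose_def restrict_def
          openin_open_subtopology fun_eq_iff qD)
  next
    case (5 U a \<phi>)
    then show ?case
      using H.smult_closed[OF 5]
      by (auto simp: hom_pullback_def hom_sheaf_def hom_comp_def compose_def restrict_def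
          openin_open_subtopology fun_eq_iff qD)
  next
    case (6 U V \<phi>)
    then show ?case
      using H.P.restr_closed[OF 6]
      by (auto simp: hom_pullback_def hom_sheaf_def hom_comp_def compose_def restrict_def
          openin_open_subtopology fun_eq_iff qD)
  qed (simp_all add: hom_pullback_def secs_H)
qed


section \<open>The sheaf generated by a presheaf of modules\<close>

context presheaf
begin

lemma germ_subset_germ:
  assumes U: "openin T U" "s \<in> secs F U" and V: "openin T V" "t \<in> secs F V"
    and W: "openin T W" "x \<in> W" "W \<subseteq> U" "W \<subseteq> V" "restr F U W s = restr F V W t"
  shows "germ T F x U s \<subseteq> germ T F x V t"
proof (rule subsetI, clarify)
  fix V' t' assume "(V', t') \<in> germ T F x U s"
  then obtain W' where V': "openin T V'" "x \<in> V'" "t' \<in> secs F V'"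
    and W': "openin T W'" "x \<in> W'" "W' \<subseteq> U" "W' \<subseteq> V'" "restr F U W' s = restr F V' W' t'"
    unfolding germ_def by blast
  have I: "openin T (W \<inter> W')" using W W' by blast
  have "restr F V (W \<inter> W') t = restr F U (W \<inter> W') s"
    using W U V I restr_restr[of U W "W \<inter> W'" s] restr_restr[of V W "W \<inter> W'" t] by simp
  also have "\<dots> = restr F V' (W \<inter> W') t'"
    using W' V' U I restr_restr[of U W' "W \<inter> W'" s] restr_restr[of V' W' "W \<inter> W'" t'] by simp
  finally show "(V', t') \<in> germ T F x V t"
    unfolding germ_def using V' W W' I by blast
qed

lemma germ_eqI:
  assumes "openin T U" "s \<in> secs F U" "openin T V" "t \<in> secs F V"
    and "openin T W" "x \<in> W" "W \<subseteq> U" "W \<subseteq> V" "restr F U W s = restr F V W t"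
  shows "germ T F x U s = germ T F x V t"
  using germ_subset_germ[OF assms] germ_subset_germ[OF assms(3,4,1,2,5,6,8,7) assms(9)[symmetric]]
  by blast

lemma germ_self:
  "\<lbrakk>openin T U; x \<in> U; s \<in> secs F U\<rbrakk> \<Longrightarrow> (U, s) \<in> germ T F x U s"
  unfolding germ_def by auto

lemma germ_eqD:
  assumes "openin T V" "x \<in> V" "t \<in> secs F V" "germ T F x U s = germ T F x V t"
  obtains W where "openin T W" "x \<in> W" "W \<subseteq> U" "W \<subseteq> V" "restr F U W s = restr F V W t"
proof -
  have "(V, t) \<in> germ T F x U s" using germ_self[OF assms(1-3)] assms(4) by simp
  then show ?thesis using that unfolding germ_def by blast
qed

lemma germ_restr:
  assumes "openin T U" "s \<in> secs F U" "openin T V" "V \<subseteq> U" "x \<in> V"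
  shows "germ T F x V (restr F U V s) = germ T F x U s"
  using assms by (intro germ_eqI[of V _ U s V]) (simp_all add: restr_closed restr_id)

end

context module_presheaf
begin

text \<open>
  Addition of germs does not depend on representatives: two pairs of representatives agree on a
  common neighbourhood, where restriction is additive. The union in the definition of \<open>germ_add\<close> is
  therefore over a nonempty family of equal sets.
\<close>
lemma germ_add_germ:
  assumes U: "openin T U" "s \<in> secs P U" and V: "openin T V" "t \<in> secs P V"
    and x: "x \<in> U" "x \<in> V"
  shows "germ_add T P x (germ T P x U s) (germ T P x V t) =
    germ T P x (U \<inter> V) (restr P U (U \<inter> V) s \<oplus>\<^bsub>sections P (U \<inter> V)\<^esub> restr P V (U \<inter> V) t)"
    (is "_ = germ T P x _ ?sum")
proof -
  have eq: "germ T P x (U' \<inter> V')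
      (restr P U' (U' \<inter> V') s' \<oplus>\<^bsub>sections P (U' \<inter> V')\<^esub> restr P V' (U' \<inter> V') t') =
      germ T P x (U \<inter> V) ?sum"
    if s': "(U', s') \<in> germ T P x U s" and t': "(V', t') \<in> germ T P x V t" for U' s' V' t'
  proof -
    obtain W where U': "openin T U'" "s' \<in> secs P U'"
      and W: "openin T W" "x \<in> W" "W \<subseteq> U" "W \<subseteq> U'" "restr P U W s = restr P U' W s'"
      using s' unfolding germ_def by blast
    obtain W' where V': "openin T V'" "t' \<in> secs P V'"
      and W': "openin T W'" "x \<in> W'" "W' \<subseteq> V" "W' \<subseteq> V'" "restr P V W' t = restr P V' W' t'"
      using t' unfolding germ_def by blast
    have I: "openin T (U \<inter> V)" "openin T (U' \<inter> V')" "openin T (W \<inter> W')"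
      using U V U' V' W W' by blast+
    have "restr P U (W \<inter> W') s = restr P U' (W \<inter> W') s'"
      using W I U U' P.restr_restr[of U W "W \<inter> W'" s] P.restr_restr[of U' W "W \<inter> W'" s'] by simp
    moreover have "restr P V (W \<inter> W') t = restr P V' (W \<inter> W') t'"
      using W' I V V' P.restr_restr[of V W' "W \<inter> W'" t] P.restr_restr[of V' W' "W \<inter> W'" t'] by simp
    moreover have "W \<inter> W' \<subseteq> U \<inter> V" "W \<inter> W' \<subseteq> U' \<inter> V'" using W W' by blast+
    ultimately show ?thesis
      using I U V U' V' W(2) W'(2)
      by (intro P.germ_eqI[of "U' \<inter> V'" _ "U \<inter> V" _ "W \<inter> W'"])
        (simp_all add: add_closed P.restr_closed restr_add P.restr_restr)
  qed
  have self: "(U, s) \<in> germ T P x U s" "(V, t) \<in> germ T P x V t"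
    using assms P.germ_self by auto
  show ?thesis
  proof (rule subset_antisym)
    show "germ_add T P x (germ T P x U s) (germ T P x V t) \<subseteq> germ T P x (U \<inter> V) ?sum"
      unfolding germ_add_def using eq by blast
    show "germ T P x (U \<inter> V) ?sum \<subseteq> germ_add T P x (germ T P x U s) (germ T P x V t)"
      unfolding germ_add_def using self by blast
  qed
qed

lemma germ_smult_germ:
  assumes U: "openin T U" "a \<in> secs A U" and V: "openin T V" "s \<in> secs P V"
    and x: "x \<in> U" "x \<in> V"
  shows "germ_smult T A P x U a (germ T P x V s) =
    germ T P x (U \<inter> V) (restr A U (U \<inter> V) a \<odot>\<^bsub>sections P (U \<inter> V)\<^esub> restr P V (U \<inter> V) s)"
    (is "_ = germ T P x _ ?prod")
proof -
  have eq: "germ T P x (U \<inter> V')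
      (restr A U (U \<inter> V') a \<odot>\<^bsub>sections P (U \<inter> V')\<^esub> restr P V' (U \<inter> V') s') =
      germ T P x (U \<inter> V) ?prod"
    if s': "(V', s') \<in> germ T P x V s" for V' s'
  proof -
    obtain W where V': "openin T V'" "s' \<in> secs P V'"
      and W: "openin T W" "x \<in> W" "W \<subseteq> V" "W \<subseteq> V'" "restr P V W s = restr P V' W s'"
      using s' unfolding germ_def by blast
    have I: "openin T (U \<inter> V)" "openin T (U \<inter> V')" "openin T (U \<inter> W)"
      using U V V' W by blast+
    have "restr P V (U \<inter> W) s = restr P V' (U \<inter> W) s'"
      using W I V V' P.restr_restr[of V W "U \<inter> W" s] P.restr_restr[of V' W "U \<inter> W" s'] by simp
    moreover have "U \<inter> W \<subseteq> U \<inter> V" "U \<inter> W \<subseteq> U \<inter> V'" using W by blast+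
    ultimately show ?thesis
      using I U V V' W(2) x
      by (intro P.germ_eqI[of "U \<inter> V'" _ "U \<inter> V" _ "U \<inter> W"])
        (simp_all add: smult_closed P.restr_closed A.restr_closed restr_smult
          P.restr_restr A.restr_restr)
  qed
  have self: "(V, s) \<in> germ T P x V s" using assms P.germ_self by auto
  show ?thesis
  proof (rule subset_antisym)
    show "germ_smult T A P x U a (germ T P x V s) \<subseteq> germ T P x (U \<inter> V) ?prod"
      unfolding germ_smult_def using eq by blast
    show "germ T P x (U \<inter> V) ?prod \<subseteq> germ_smult T A P x U a (germ T P x V s)"
      unfolding germ_smult_def using self by blast
  qed
qed

lemma generated_sheaf_secs_iff:
  "\<sigma> \<in> secs (generated_sheaf T A P) U \<longleftrightarrow> \<sigma> \<in> extensional U \<and>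
    (\<forall>x\<in>U. \<exists>V s. openin T V \<and> x \<in> V \<and> V \<subseteq> U \<and> s \<in> secs P V \<and> (\<forall>y\<in>V. \<sigma> y = germ T P y V s))"
  by (simp add: generated_sheaf_def Bex_def)

lemma generated_sheaf_secsE:
  assumes "\<sigma> \<in> secs (generated_sheaf T A P) U" "x \<in> U"
  obtains V s where "openin T V" "x \<in> V" "V \<subseteq> U" "s \<in> secs P V"
    "\<And>y. y \<in> V \<Longrightarrow> \<sigma> y = germ T P y V s"
proof -
  have "\<exists>V s. openin T V \<and> x \<in> V \<and> V \<subseteq> U \<and> s \<in> secs P V \<and> (\<forall>y\<in>V. \<sigma> y = germ T P y V s)"
    using assms unfolding generated_sheaf_secs_iff by simp
  then show ?thesis using that by metis
qed

lemma generated_sheaf_add_closed: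
  assumes "openin T U" and \<sigma>: "\<sigma> \<in> secs (generated_sheaf T A P) U"
    and \<tau>: "\<tau> \<in> secs (generated_sheaf T A P) U"
  shows "\<sigma> \<oplus>\<^bsub>sections (generated_sheaf T A P) U\<^esub> \<tau> \<in> secs (generated_sheaf T A P) U"
  unfolding generated_sheaf_secs_iff
proof (intro conjI ballI)
  show "\<sigma> \<oplus>\<^bsub>sections (generated_sheaf T A P) U\<^esub> \<tau> \<in> extensional U"
    by (simp add: generated_sheaf_def)
  fix x assume x: "x \<in> U"
  obtain V s where V: "openin T V" "x \<in> V" "V \<subseteq> U" "s \<in> secs P V"
    "\<And>y. y \<in> V \<Longrightarrow> \<sigma> y = germ T P y V s"
    using generated_sheaf_secsE[OF \<sigma> x] by blast
  obtain W t where W: "openin T W" "x \<in> W" "W \<subseteq> U" "t \<in> secs P W"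
    "\<And>y. y \<in> W \<Longrightarrow> \<tau> y = germ T P y W t"
    using generated_sheaf_secsE[OF \<tau> x] by blast
  have I: "openin T (V \<inter> W)" using V W by blast
  let ?r = "restr P V (V \<inter> W) s \<oplus>\<^bsub>sections P (V \<inter> W)\<^esub> restr P W (V \<inter> W) t"
  have "?r \<in> secs P (V \<inter> W)" using V W I by (simp add: add_closed P.restr_closed)
  moreover have "(\<sigma> \<oplus>\<^bsub>sections (generated_sheaf T A P) U\<^esub> \<tau>) y = germ T P y (V \<inter> W) ?r"
    if "y \<in> V \<inter> W" for y
    using that V W by (auto simp: generated_sheaf_def germ_add_germ)
  ultimately show "\<exists>V s. openin T V \<and> x \<in> V \<and> V \<subseteq> U \<and> s \<in> secs P V \<and>
      (\<forall>y\<in>V. (\<sigma> \<oplus>\<^bsub>sections (generated_sheaf T A P) U\<^esub> \<tau>) y = germ T P y V s)"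
    using I V(2,3) W(2) by (intro exI[of _ "V \<inter> W"] exI[of _ ?r]) auto
qed

lemma generated_sheaf_smult_closed:
  assumes U: "openin T U" and a: "a \<in> secs A U" and \<sigma>: "\<sigma> \<in> secs (generated_sheaf T A P) U"
  shows "a \<odot>\<^bsub>sections (generated_sheaf T A P) U\<^esub> \<sigma> \<in> secs (generated_sheaf T A P) U"
  unfolding generated_sheaf_secs_iff
proof (intro conjI ballI)
  show "a \<odot>\<^bsub>sections (generated_sheaf T A P) U\<^esub> \<sigma> \<in> extensional U"
    by (simp add: generated_sheaf_def)
  fix x assume x: "x \<in> U"
  obtain V s where V: "openin T V" "x \<in> V" "V \<subseteq> U" "s \<in> secs P V"
    "\<And>y. y \<in> V \<Longrightarrow> \<sigma> y = germ T P y V s"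
    using generated_sheaf_secsE[OF \<sigma> x] by blast
  have UV: "U \<inter> V = V" using V by blast
  let ?r = "restr A U V a \<odot>\<^bsub>sections P V\<^esub> s"
  have "?r \<in> secs P V" using V U a by (simp add: smult_closed A.restr_closed)
  moreover have "(a \<odot>\<^bsub>sections (generated_sheaf T A P) U\<^esub> \<sigma>) y = germ T P y V ?r"
    if "y \<in> V" for y
    using that V germ_smult_germ[OF U a V(1,4), of y]
    by (auto simp: generated_sheaf_def UV P.restr_id)
  ultimately show "\<exists>V s. openin T V \<and> x \<in> V \<and> V \<subseteq> U \<and> s \<in> secs P V \<and>
      (\<forall>y\<in>V. (a \<odot>\<^bsub>sections (generated_sheaf T A P) U\<^esub> \<sigma>) y = germ T P y V s)"
    using V(1-3) by (intro exI[of _ V] exI[of _ ?r]) auto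
qed

text \<open>
  A scalar acts on the stalk at \<open>x\<close> through its germ, so replacing it by its restriction to a
  smaller neighbourhood of \<open>x\<close> does not change the product.
\<close>
lemma germ_smult_restr:
  assumes U: "openin T U" and V: "openin T V" "V \<subseteq> U" and a: "a \<in> secs A U"
    and \<sigma>: "\<sigma> \<in> secs (generated_sheaf T A P) U" and x: "x \<in> V"
  shows "germ_smult T A P x U a (\<sigma> x) = germ_smult T A P x V (restr A U V a) (\<sigma> x)"
proof -
  have "x \<in> U" using V x by blast
  then obtain W s where W: "openin T W" "x \<in> W" "W \<subseteq> U" "s \<in> secs P W" "\<sigma> x = germ T P x W s"
    using generated_sheaf_secsE[OF \<sigma>] by metis
  have I: "openin T (V \<inter> W)" "V \<inter> W \<subseteq> U \<inter> W" "openin T (U \<inter> W)" "V \<inter> W \<subseteq> W"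
    using V W U by blast+
  have "germ T P x (U \<inter> W) (restr A U (U \<inter> W) a \<odot>\<^bsub>sections P (U \<inter> W)\<^esub> restr P W (U \<inter> W) s) =
    germ T P x (V \<inter> W)
      (restr A V (V \<inter> W) (restr A U V a) \<odot>\<^bsub>sections P (V \<inter> W)\<^esub> restr P W (V \<inter> W) s)"
    using I U V W x a
    by (intro P.germ_eqI[of _ _ _ _ "V \<inter> W"])
      (simp_all add: smult_closed P.restr_closed A.restr_closed restr_smult
        P.restr_restr A.restr_restr P.restr_id)
  then show ?thesis
    using germ_smult_germ[OF U a W(1,4) \<open>x \<in> U\<close> W(2)]
      germ_smult_germ[OF V(1) A.restr_closed[OF U V a] W(1,4) x W(2)] W(5) by simp
qed

lemma generated_sheaf_module_presheaf: "module_presheaf T A (generated_sheaf T A P)"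
proof (intro module_presheaf.intro presheaf.intro module_presheaf_axioms.intro, goal_cases)
  case 1
  show ?case ..
next
  case (2 U V \<sigma>)
  show ?case
    unfolding generated_sheaf_secs_iff
  proof (intro conjI ballI)
    show "restr (generated_sheaf T A P) U V \<sigma> \<in> extensional V" by (simp add: generated_sheaf_def)
    fix x assume x: "x \<in> V"
    then have "x \<in> U" using 2 by blast
    then obtain W s where W: "openin T W" "x \<in> W" "W \<subseteq> U" "s \<in> secs P W"
      "\<And>y. y \<in> W \<Longrightarrow> \<sigma> y = germ T P y W s"
      using generated_sheaf_secsE[OF 2(4)] by metis
    have "openin T (V \<inter> W)" using 2 W by blast
    then show "\<exists>W s. openin T W \<and> x \<in> W \<and> W \<subseteq> V \<and> s \<in> secs P W \<and>
        (\<forall>y\<in>W. restr (generated_sheaf T A P) U V \<sigma> y = germ T P y W s)"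
      using W x by (intro exI[of _ "V \<inter> W"] exI[of _ "restr P W (V \<inter> W) s"])
        (simp add: generated_sheaf_def P.restr_closed P.germ_restr)
  qed
next
  case (3 U \<sigma>)
  then show ?case by (simp add: generated_sheaf_def extensional_restrict)
next
  case (4 U V W \<sigma>)
  then show ?case by (auto simp: generated_sheaf_def restrict_def fun_eq_iff)
next
  case 5
  then show ?case by (rule generated_sheaf_add_closed)
next
  case 6
  then show ?case by (rule generated_sheaf_smult_closed)
next
  case (7 U V \<sigma> \<tau>)
  then show ?case by (auto simp: generated_sheaf_def restrict_def fun_eq_iff)
next
  case (8 U V a \<sigma>)
  then show ?case
    using germ_smult_restr[OF 8] by (auto simp: generated_sheaf_def restrict_def fun_eq_iff)
qed

end

text \<open>
  The canonical morphism from a presheaf to the sheaf it generates, i.e. the unit of sheafification.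
\<close>
definition generated_unit ::
  "'a topology \<Rightarrow> ('a, 'r, 'e) module_data \<Rightarrow> ('a set \<Rightarrow> 'e \<Rightarrow> 'a \<Rightarrow> ('a set \<times> 'e) set)" where
  "generated_unit T P = (\<lambda>U\<in>{U. openin T U}. \<lambda>s\<in>secs P U. \<lambda>x\<in>U. germ T P x U s)"

context module_presheaf
begin

lemma generated_unit_in_sheaf_homs:
  "generated_unit T P \<in> sheaf_homs T A P (generated_sheaf T A P)"
proof (rule sheaf_homsI, goal_cases)
  case (3 U s)
  then show ?case
    unfolding generated_sheaf_secs_iff by (auto simp: generated_unit_def)
next
  case (4 U s t)
  then show ?case
    using germ_add_germ[OF 4(1,2,1,3)]
    by (auto simp: generated_unit_def generated_sheaf_def add_closed P.restr_id fun_eq_iff)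
next
  case (5 U a s)
  then show ?case
    using germ_smult_germ[OF 5(1,2,1,3)]
    by (auto simp: generated_unit_def generated_sheaf_def smult_closed P.restr_id A.restr_id
        fun_eq_iff)
next
  case (6 U V s)
  then show ?case
    using P.germ_restr[OF 6(1,4,2,3)]
    by (auto simp: generated_unit_def generated_sheaf_def P.restr_closed fun_eq_iff)
qed (simp_all add: generated_unit_def)

lemma generated_unit_locally_surj:
  assumes "\<sigma> \<in> secs (generated_sheaf T A P) U" "x \<in> U"
  obtains W s where "openin T W" "x \<in> W" "W \<subseteq> U" "s \<in> secs P W"
    "restr (generated_sheaf T A P) U W \<sigma> = generated_unit T P W s"
proof -
  obtain W s where W: "openin T W" "x \<in> W" "W \<subseteq> U" "s \<in> secs P W"
    "\<And>y. y \<in> W \<Longrightarrow> \<sigma> y = germ T P y W s"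
    using generated_sheaf_secsE[OF assms] by blast
  then have "restr (generated_sheaf T A P) U W \<sigma> = generated_unit T P W s"
    by (auto simp: generated_sheaf_def generated_unit_def restrict_def fun_eq_iff)
  with W that show ?thesis by blast
qed

lemma generated_unit_eqD:
  assumes U: "openin T U" and s: "s \<in> secs P U" and t: "t \<in> secs P U"
    and eq: "generated_unit T P U s = generated_unit T P U t" and x: "x \<in> U"
  obtains W where "openin T W" "x \<in> W" "W \<subseteq> U" "restr P U W s = restr P U W t"
proof -
  have "germ T P x U s = germ T P x U t"
    using fun_cong[OF eq, of x] assms by (simp add: generated_unit_def)
  then show ?thesis by (rule P.germ_eqD[OF U x t]) (rule that)
qed

end


section \<open>The quotient and the annihilator of a subsheaf\<close>

locale subsheaf_of_modules = E: module_sheaf T A E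
  for T :: "'a topology" and A :: "('a, 'r) algebra_data" and E F :: "('a, 'r, 'e) module_data" +
  assumes submodule_sheaf: "submodule_sheaf T A F E"
begin

lemma F_module_sheaf: "module_sheaf T A F"
  using submodule_sheaf unfolding submodule_sheaf_def by blast

sublocale F: module_sheaf T A F by (rule F_module_sheaf)

lemma F_subset: "openin T U \<Longrightarrow> secs F U \<subseteq> secs E U"
  using submodule_sheaf unfolding submodule_sheaf_def by blast

lemma inclusion:
  "(\<lambda>U\<in>{U. openin T U}. \<lambda>s\<in>secs F U. s) \<in> sheaf_homs T A F E"
  using submodule_sheaf unfolding submodule_sheaf_def by blast

lemma F_add:
  "\<lbrakk>openin T U; s \<in> secs F U; t \<in> secs F U\<rbrakk> \<Longrightarrow> s \<oplus>\<^bsub>sections F U\<^esub> t = s \<oplus>\<^bsub>sections E U\<^esub> t"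
  using sheaf_hom_add[OF inclusion, of U s t] by (simp add: F.MP.add_closed)

lemma F_smult:
  "\<lbrakk>openin T U; a \<in> secs A U; s \<in> secs F U\<rbrakk> \<Longrightarrow> a \<odot>\<^bsub>sections F U\<^esub> s = a \<odot>\<^bsub>sections E U\<^esub> s"
  using sheaf_hom_smult[OF inclusion, of U a s] by (simp add: F.MP.smult_closed)

lemma F_restr:
  "\<lbrakk>openin T U; openin T V; V \<subseteq> U; s \<in> secs F U\<rbrakk> \<Longrightarrow> restr F U V s = restr E U V s"
  using sheaf_hom_restr[OF inclusion, of U V s] by (simp add: F.E.restr_closed)

lemma F_smult_closed:
  "\<lbrakk>openin T U; a \<in> secs A U; s \<in> secs F U\<rbrakk> \<Longrightarrow> a \<odot>\<^bsub>sections E U\<^esub> s \<in> secs F U"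
  using F.MP.smult_closed F_smult by metis

lemma F_restr_closed:
  "\<lbrakk>openin T U; openin T V; V \<subseteq> U; s \<in> secs F U\<rbrakk> \<Longrightarrow> restr E U V s \<in> secs F V"
  using F.E.restr_closed F_restr by metis

text \<open>
  The sections of \<open>F\<close> have their own zero and negatives. They coincide with those of \<open>E\<close> because zero
  is the only idempotent of a group and negatives are unique.
\<close>
lemma F_abelian_subgroup:
  assumes U: "openin T U"
  shows "abelian_subgroup (secs F U) (sections E U)"
proof -
  interpret EU: module "sections A U" "sections E U" by (rule E.module_sections[OF U])
  interpret FU: module "sections A U" "sections F U" by (rule F.module_sections[OF U])
  note sub = subsetD[OF F_subset[OF U]]
  have "\<zero>\<^bsub>sections F U\<^esub> \<oplus>\<^bsub>sections E U\<^esub> \<zero>\<^bsub>sections F U\<^esub> = \<zero>\<^bsub>sections F U\<^esub>"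
    using F_add[OF U, of "\<zero>\<^bsub>sections F U\<^esub>" "\<zero>\<^bsub>sections F U\<^esub>"] by simp
  then have zero: "\<zero>\<^bsub>sections F U\<^esub> = \<zero>\<^bsub>sections E U\<^esub>"
    using EU.M.add.r_cancel_one[of "\<zero>\<^bsub>sections F U\<^esub>" "\<zero>\<^bsub>sections F U\<^esub>"] sub[of "\<zero>\<^bsub>sections F U\<^esub>"]
    by simp
  have minus: "\<ominus>\<^bsub>sections E U\<^esub> s = \<ominus>\<^bsub>sections F U\<^esub> s" if s: "s \<in> secs F U" for s
  proof (rule EU.M.minus_equality)
    show "\<ominus>\<^bsub>sections F U\<^esub> s \<oplus>\<^bsub>sections E U\<^esub> s = \<zero>\<^bsub>sections E U\<^esub>"
      using F_add[OF U, of "\<ominus>\<^bsub>sections F U\<^esub> s" s] s zero by (simp add: FU.M.l_neg)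
  qed (use s sub in auto)
  have "submodule (secs F U) (sections A U) (sections E U)"
  proof (rule EU.submoduleI)
    show "secs F U \<subseteq> secs E U" by (rule F_subset[OF U])
    show "\<zero>\<^bsub>sections E U\<^esub> \<in> secs F U" using zero FU.M.zero_closed by simp
    show "\<ominus>\<^bsub>sections E U\<^esub> s \<in> secs F U" if "s \<in> secs F U" for s
      using that minus by simp
    show "s \<oplus>\<^bsub>sections E U\<^esub> t \<in> secs F U" if "s \<in> secs F U" "t \<in> secs F U" for s t
      using that F_add[OF U] FU.M.a_closed by metis
  qed (rule F_smult_closed[OF U])
  then have "subgroup (secs F U) (add_monoid (sections E U))" by (rule submodule.axioms(1))
  then show ?thesis
    by (intro abelian_subgroupI3 additive_subgroupI EU.M.abelian_group_axioms)
qed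

abbreviation coset :: "'a set \<Rightarrow> 'e \<Rightarrow> 'e set" where
  "coset U s \<equiv> secs F U +>\<^bsub>sections E U\<^esub> s"

lemma coset_eq_iff:
  assumes U: "openin T U" and s: "s \<in> secs E U" and t: "t \<in> secs E U"
  shows "coset U s = coset U t \<longleftrightarrow> (\<exists>f\<in>secs F U. s = f \<oplus>\<^bsub>sections E U\<^esub> t)"
proof -
  interpret FU: abelian_subgroup "secs F U" "sections E U" by (rule F_abelian_subgroup[OF U])
  have "coset U s = coset U t \<longleftrightarrow> s \<in> coset U t"
    using FU.a_repr_independence'[of s t] FU.a_repr_independenceD[of s t] s t by auto
  then show ?thesis by (auto simp: a_r_coset_def')
qed

lemma in_cosetD:
  assumes "s' \<in> coset U s"
  obtains f where "f \<in> secs F U" "s' = f \<oplus>\<^bsub>sections E U\<^esub> s"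
  using assms by (auto simp: a_r_coset_def')

text \<open>
  The operations and restrictions of the presheaf quotient are unions over all representatives of
  a coset. An operation that is constant on the coset can be computed on one of them.
\<close>
lemma Union_coset:
  assumes U: "openin T U" and s: "s \<in> secs E U"
    and "\<And>f. f \<in> secs F U \<Longrightarrow> g (f \<oplus>\<^bsub>sections E U\<^esub> s) = g s"
  shows "(\<Union>s'\<in>coset U s. g s') = g s"
proof -
  interpret FU: abelian_subgroup "secs F U" "sections E U" by (rule F_abelian_subgroup[OF U])
  have "g s' = g s" if "s' \<in> coset U s" for s' using that assms(3) by (metis in_cosetD)
  then show ?thesis using FU.a_rcos_self[OF s] by blast
qed

lemma quotient_secs:
  "secs (quotient_presheaf E F) U = coset U ` secs E U"
  by (auto simp: quotient_presheaf_def A_RCOSETS_def')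

lemma quotient_add:
  assumes U: "openin T U" and "s \<in> secs E U" "t \<in> secs E U"
  shows "coset U s \<oplus>\<^bsub>sections (quotient_presheaf E F) U\<^esub> coset U t =
    coset U (s \<oplus>\<^bsub>sections E U\<^esub> t)"
proof -
  interpret FU: abelian_subgroup "secs F U" "sections E U" by (rule F_abelian_subgroup[OF U])
  show ?thesis using assms by (simp add: quotient_presheaf_def FU.a_rcos_sum)
qed

lemma quotient_smult:
  assumes U: "openin T U" and a: "a \<in> secs A U" and s: "s \<in> secs E U"
  shows "a \<odot>\<^bsub>sections (quotient_presheaf E F) U\<^esub> coset U s = coset U (a \<odot>\<^bsub>sections E U\<^esub> s)"
proof -
  interpret EU: module "sections A U" "sections E U" by (rule E.module_sections[OF U])
  have "coset U (a \<odot>\<^bsub>sections E U\<^esub> (f \<oplus>\<^bsub>sections E U\<^esub> s)) = coset U (a \<odot>\<^bsub>sections E U\<^esub> s)"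
    if f: "f \<in> secs F U" for f
  proof -
    have fE: "f \<in> secs E U" using f F_subset[OF U] by blast
    show ?thesis
      using F_smult_closed[OF U a f] a s fE
      by (subst coset_eq_iff[OF U]) (auto simp: EU.smult_r_distr)
  qed
  from Union_coset[OF U s, of "\<lambda>s. coset U (a \<odot>\<^bsub>sections E U\<^esub> s)", OF this]
  show ?thesis by (simp add: quotient_presheaf_def)
qed

lemma quotient_restr:
  assumes U: "openin T U" and V: "openin T V" "V \<subseteq> U" and s: "s \<in> secs E U"
  shows "restr (quotient_presheaf E F) U V (coset U s) = coset V (restr E U V s)"
proof -
  have "coset V (restr E U V (f \<oplus>\<^bsub>sections E U\<^esub> s)) = coset V (restr E U V s)"
    if f: "f \<in> secs F U" for f
  proof -
    have fE: "f \<in> secs E U" using f F_subset[OF U] by blast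
    show ?thesis
      using F_restr_closed[OF U V f] s fE
      by (subst coset_eq_iff[OF V(1)])
        (auto simp: E.restr_add[OF U V] E.E.restr_closed[OF U V] E.MP.add_closed U V(1))
  qed
  from Union_coset[OF U s, of "\<lambda>s. coset V (restr E U V s)", OF this]
  show ?thesis by (simp add: quotient_presheaf_def)
qed

lemma quotient_presheaf_module_presheaf: "module_presheaf T A (quotient_presheaf E F)"
  by (intro module_presheaf.intro presheaf.intro module_presheaf_axioms.intro)
    (auto simp: E.A.algebra_sheaf_axioms quotient_secs quotient_add quotient_smult quotient_restr
      E.E.restr_closed E.E.restr_id E.E.restr_restr E.MP.add_closed E.MP.smult_closed
      E.restr_add E.restr_smult E.A.restr_closed)

sublocale quot: module_presheaf T A "quotient_presheaf E F"
  by (rule quotient_presheaf_module_presheaf)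

lemma quotient_sheaf_module_presheaf: "module_presheaf T A (quotient_sheaf T A E F)"
  unfolding quotient_sheaf_def by (rule quot.generated_sheaf_module_presheaf)

sublocale Q: module_presheaf T A "quotient_sheaf T A E F"
  by (rule quotient_sheaf_module_presheaf)

definition coset_hom :: "'a set \<Rightarrow> 'e \<Rightarrow> 'e set" where
  "coset_hom = (\<lambda>U\<in>{U. openin T U}. \<lambda>s\<in>secs E U. coset U s)"

lemma coset_hom_in_sheaf_homs: "coset_hom \<in> sheaf_homs T A E (quotient_presheaf E F)"
  by (rule sheaf_homsI)
    (auto simp: coset_hom_def quotient_secs quotient_add quotient_smult quotient_restr
      E.E.restr_closed E.MP.add_closed E.MP.smult_closed)

definition quotient_map :: "'a set \<Rightarrow> 'e \<Rightarrow> 'a \<Rightarrow> ('a set \<times> 'e set) set" where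
  "quotient_map = hom_comp T E (generated_unit T (quotient_presheaf E F)) coset_hom"

lemma quotient_map_in_sheaf_homs: "quotient_map \<in> sheaf_homs T A E (quotient_sheaf T A E F)"
  unfolding quotient_map_def quotient_sheaf_def
  by (intro hom_comp_in_sheaf_homs[OF E.MP.module_presheaf_axioms coset_hom_in_sheaf_homs]
      quot.generated_unit_in_sheaf_homs)

lemma quotient_map_apply:
  "\<lbrakk>openin T U; s \<in> secs E U\<rbrakk>
    \<Longrightarrow> quotient_map U s = generated_unit T (quotient_presheaf E F) U (coset U s)"
  by (simp add: quotient_map_def hom_comp_apply coset_hom_def)

lemma quotient_map_locally_surj:
  assumes "\<tau> \<in> secs (quotient_sheaf T A E F) U" "x \<in> U"
  obtains W s where "openin T W" "x \<in> W" "W \<subseteq> U" "s \<in> secs E W"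
    "restr (quotient_sheaf T A E F) U W \<tau> = quotient_map W s"
proof -
  obtain W C where W: "openin T W" "x \<in> W" "W \<subseteq> U" "C \<in> secs (quotient_presheaf E F) W"
    "restr (quotient_sheaf T A E F) U W \<tau> = generated_unit T (quotient_presheaf E F) W C"
    using assms unfolding quotient_sheaf_def by (rule quot.generated_unit_locally_surj)
  then obtain s where "s \<in> secs E W" "C = coset W s" unfolding quotient_secs by blast
  with W that show ?thesis by (simp add: quotient_map_apply)
qed

lemma quotient_map_eqD:
  assumes U: "openin T U" and s: "s \<in> secs E U" and t: "t \<in> secs E U"
    and eq: "quotient_map U s = quotient_map U t" and x: "x \<in> U"
  obtains W f where "openin T W" "x \<in> W" "W \<subseteq> U" "f \<in> secs F W"
    "restr E U W s = f \<oplus>\<^bsub>sections E W\<^esub> restr E U W t"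
proof -
  have "generated_unit T (quotient_presheaf E F) U (coset U s) =
      generated_unit T (quotient_presheaf E F) U (coset U t)"
    using eq U s t by (simp add: quotient_map_apply)
  moreover have "coset U s \<in> secs (quotient_presheaf E F) U"
    "coset U t \<in> secs (quotient_presheaf E F) U"
    using s t by (simp_all add: quotient_secs)
  ultimately obtain W where W: "openin T W" "x \<in> W" "W \<subseteq> U"
    "restr (quotient_presheaf E F) U W (coset U s) = restr (quotient_presheaf E F) U W (coset U t)"
    using quot.generated_unit_eqD[OF U _ _ _ x] by blast
  then have "coset W (restr E U W s) = coset W (restr E U W t)"
    using quotient_restr[OF U W(1,3)] s t by simp
  then show ?thesis
    using that[OF W(1-3)] coset_eq_iff[OF W(1)] E.E.restr_closed[OF U W(1,3)] s t by blast
qed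

lemma quotient_map_F:
  assumes U: "openin T U" and f: "f \<in> secs F U"
  shows "quotient_map U f = quotient_map U \<zero>\<^bsub>sections E U\<^esub>"
proof -
  interpret EU: module "sections A U" "sections E U" by (rule E.module_sections[OF U])
  have fE: "f \<in> secs E U" using f F_subset[OF U] by blast
  have "coset U f = coset U \<zero>\<^bsub>sections E U\<^esub>"
    using f fE by (subst coset_eq_iff[OF U]) (auto intro!: bexI[of _ f])
  then show ?thesis using fE by (simp add: quotient_map_apply U)
qed

sublocale O: module_sheaf T A "structure_module A"
  by (rule E.A.module_sheaf_structure_module)

lemma structure_module_simps:
  "secs (structure_module A) U = secs A U"
  "add (sections (structure_module A) U) = add (sections A U)"
  "module.smult (sections (structure_module A) U) = monoid.mult (sections A U)"
  "restr (structure_module A) = restr A"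
  by (simp_all add: structure_module_def)

lemma annihilator_secs_iff:
  "t \<in> secs (annihilator_presheaf T A E F) U \<longleftrightarrow>
    t \<in> sheaf_homs (subtopology T U) A E (structure_module A) \<and>
    (\<forall>V. openin T V \<longrightarrow> V \<subseteq> U \<longrightarrow> (\<forall>s\<in>secs F V. t V s = \<zero>\<^bsub>sections A V\<^esub>))"
  by (simp add: annihilator_presheaf_def dual_def hom_sheaf_def)

lemma annihilator_simps:
  "add (sections (annihilator_presheaf T A E F) U) = add (sections (dual T A E) U)"
  "module.smult (sections (annihilator_presheaf T A E F) U) = module.smult (sections (dual T A E) U)"
  "restr (annihilator_presheaf T A E F) = restr (dual T A E)"
  by (simp_all add: annihilator_presheaf_def)

lemma dual_restr: "restr (dual T A E) U V t = restrict t {W. openin (subtopology T V) W}"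
  by (simp add: dual_def hom_sheaf_def)

lemma annihilator_presheaf_module_presheaf: "module_presheaf T A (annihilator_presheaf T A E F)"
proof -
  interpret D: module_presheaf T A "dual T A E"
    unfolding dual_def
    by (rule hom_sheaf_module_presheaf[OF E.MP.module_presheaf_axioms O.module_sheaf_axioms])
  have D: "t \<in> secs (annihilator_presheaf T A E F) U \<longleftrightarrow> t \<in> secs (dual T A E) U \<and>
    (\<forall>V. openin T V \<longrightarrow> V \<subseteq> U \<longrightarrow> (\<forall>s\<in>secs F V. t V s = \<zero>\<^bsub>sections A V\<^esub>))" for U t
    by (simp add: annihilator_presheaf_def)
  show ?thesis
  proof (intro module_presheaf.intro presheaf.intro module_presheaf_axioms.intro, goal_cases)
    case 1
    show ?case ..
  next
    case (2 U V t)
    then show ?case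
      using D.P.restr_closed[OF 2(1-3)]
      by (auto simp: D annihilator_simps dual_restr openin_open_subtopology)
  next
    case (5 U s t)
    have "(s \<oplus>\<^bsub>sections (dual T A E) U\<^esub> t) V f = \<zero>\<^bsub>sections A V\<^esub>"
      if V: "openin T V" "V \<subseteq> U" and f: "f \<in> secs F V" for V f
    proof -
      interpret R: cring "sections A V" by (rule E.A.cring_sections[OF V(1)])
      have "f \<in> secs E V" using f F_subset[OF V(1)] by blast
      then show ?thesis
        using 5 V f by (simp add: D dual_def hom_sheaf_def structure_module_simps
            openin_open_subtopology)
    qed
    then show ?case using 5 by (simp add: D annihilator_simps D.add_closed)
  next
    case (6 U a t)
    have "(a \<odot>\<^bsub>sections (dual T A E) U\<^esub> t) V f = \<zero>\<^bsub>sections A V\<^esub>"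
      if V: "openin T V" "V \<subseteq> U" and f: "f \<in> secs F V" for V f
    proof -
      interpret R: cring "sections A V" by (rule E.A.cring_sections[OF V(1)])
      have "f \<in> secs E V" using f F_subset[OF V(1)] by blast
      then show ?thesis
        using 6 V f by (simp add: D dual_def hom_sheaf_def structure_module_simps
            openin_open_subtopology E.A.restr_closed)
    qed
    then show ?case using 6 by (simp add: D annihilator_simps D.smult_closed)
  qed (simp_all add: D annihilator_simps D.P.restr_id D.P.restr_restr D.restr_add D.restr_smult)
qed

sublocale ann: module_presheaf T A "annihilator_presheaf T A E F"
  by (rule annihilator_presheaf_module_presheaf)


section \<open>Comparing the dual of the quotient with the annihilator\<close>

abbreviation "Q \<equiv> quotient_sheaf T A E F"
abbreviation "N \<equiv> annihilator_presheaf T A E F"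
abbreviation "pull \<equiv> hom_pullback T A E Q (structure_module A) quotient_map"

definition dual_to_annihilator where
  "dual_to_annihilator = hom_comp T (dual T A Q) (generated_unit T N) pull"

lemma dual_quotient_secs: "secs (dual T A Q) U = sheaf_homs (subtopology T U) A Q (structure_module A)"
  by (simp add: dual_def hom_sheaf_def)

lemma pull_apply:
  assumes "openin T U" "\<phi> \<in> secs (dual T A Q) U" "openin T V" "V \<subseteq> U" "s \<in> secs E V"
  shows "pull U \<phi> V s = \<phi> V (quotient_map V s)"
  using assms by (simp add: dual_quotient_secs hom_pullback_apply)

lemma pull_in_sheaf_homs_dual: "pull \<in> sheaf_homs T A (dual T A Q) (dual T A E)"
  unfolding dual_def
  by (rule hom_pullback_in_sheaf_homs) (rule E.MP.module_presheaf_axioms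
      quotient_sheaf_module_presheaf O.module_sheaf_axioms quotient_map_in_sheaf_homs)+

text \<open>
  The quotient morphism identifies a section of \<open>F\<close> with \<open>0\<close>, and an additive map sends \<open>0\<close> to \<open>0\<close>.
\<close>
lemma pull_annihilates:
  assumes U: "openin T U" and \<phi>: "\<phi> \<in> secs (dual T A Q) U"
  shows "pull U \<phi> \<in> secs N U"
proof -
  have hom: "pull U \<phi> \<in> sheaf_homs (subtopology T U) A E (structure_module A)"
    using sheaf_hom_closed[OF pull_in_sheaf_homs_dual U \<phi>] by (simp add: dual_def hom_sheaf_def)
  have "pull U \<phi> V f = \<zero>\<^bsub>sections A V\<^esub>"
    if V: "openin T V" "V \<subseteq> U" and f: "f \<in> secs F V" for V f
  proof -
    interpret EV: module "sections A V" "sections E V" by (rule E.module_sections[OF V(1)])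
    have S: "openin (subtopology T U) V" using U V by (simp add: openin_open_subtopology)
    have fE: "f \<in> secs E V" using f F_subset[OF V(1)] by blast
    let ?z = "pull U \<phi> V \<zero>\<^bsub>sections E V\<^esub>"
    have z: "?z \<in> secs A V"
      using sheaf_hom_closed[OF hom S EV.M.zero_closed] by (simp add: structure_module_simps)
    have "?z \<oplus>\<^bsub>sections A V\<^esub> ?z = ?z"
      using sheaf_hom_add[OF hom S EV.M.zero_closed EV.M.zero_closed]
      by (simp add: structure_module_simps)
    then have "?z = \<zero>\<^bsub>sections A V\<^esub>" using EV.R.add.r_cancel_one[OF z z] by simp
    then show ?thesis
      using fE by (simp add: pull_apply[OF U \<phi> V] quotient_map_F[OF V(1) f])
  qed
  with hom show ?thesis unfolding annihilator_secs_iff by blast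
qed

lemma pull_in_sheaf_homs: "pull \<in> sheaf_homs T A (dual T A Q) N"
  using sheaf_homsD[OF pull_in_sheaf_homs_dual] pull_annihilates
  by (intro sheaf_homsI) (simp_all add: annihilator_simps)

lemma dual_quotient_module_presheaf: "module_presheaf T A (dual T A Q)"
  unfolding dual_def
  by (rule hom_sheaf_module_presheaf[OF quotient_sheaf_module_presheaf O.module_sheaf_axioms])

lemma dual_to_annihilator_in_sheaf_homs:
  "dual_to_annihilator \<in> sheaf_homs T A (dual T A Q) (annihilator_sheaf T A E F)"
  unfolding dual_to_annihilator_def annihilator_sheaf_def
  by (rule hom_comp_in_sheaf_homs[OF dual_quotient_module_presheaf pull_in_sheaf_homs
        ann.generated_unit_in_sheaf_homs])

lemma dual_to_annihilator_apply:
  "\<lbrakk>openin T U; \<phi> \<in> secs (dual T A Q) U\<rbrakk>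
    \<Longrightarrow> dual_to_annihilator U \<phi> = generated_unit T N U (pull U \<phi>)"
  by (simp add: dual_to_annihilator_def hom_comp_apply)

lemma annihilator_restr_apply:
  "\<lbrakk>openin T V; openin T W; W \<subseteq> V\<rbrakk> \<Longrightarrow> restr N U V t W = t W"
  by (simp add: annihilator_simps dual_restr openin_open_subtopology)

text \<open>
  The values prescribed by a section of the annihilator sheaf are well defined. Around each point
  the homomorphisms \<open>t\<close> and \<open>t'\<close> coincide and \<open>s\<close> differs from \<open>s'\<close> by a section of \<open>F\<close>, on which \<open>t\<close>
  vanishes. So the two values agree locally, hence everywhere.
\<close>
lemma annihilator_eval_well_defined:
  assumes W: "openin T W" and t: "t \<in> secs N W" "t' \<in> secs N W"
    and s: "s \<in> secs E W" "s' \<in> secs E W"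
    and t_eq: "generated_unit T N W t = generated_unit T N W t'"
    and s_eq: "quotient_map W s = quotient_map W s'"
  shows "t W s = t' W s'"
proof -
  have SW: "openin (subtopology T W) V \<longleftrightarrow> openin T V \<and> V \<subseteq> W" for V
    using W by (simp add: openin_open_subtopology)
  have th: "t \<in> sheaf_homs (subtopology T W) A E (structure_module A)"
    "t' \<in> sheaf_homs (subtopology T W) A E (structure_module A)"
    using t by (simp_all add: annihilator_secs_iff)
  show ?thesis
  proof (rule E.A.eq_if_locally_eq[OF W])
    show "t W s \<in> secs A W" "t' W s' \<in> secs A W"
      using sheaf_hom_closed[OF th(1), of W s] sheaf_hom_closed[OF th(2), of W s'] s
      by (simp_all add: SW W structure_module_simps)
    fix x assume x: "x \<in> W"
    obtain W1 where W1: "openin T W1" "x \<in> W1" "W1 \<subseteq> W" "restr N W W1 t = restr N W W1 t'"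
      using ann.generated_unit_eqD[OF W t t_eq x] by blast
    obtain W2 f where W2: "openin T W2" "x \<in> W2" "W2 \<subseteq> W" "f \<in> secs F W2"
      "restr E W W2 s = f \<oplus>\<^bsub>sections E W2\<^esub> restr E W W2 s'"
      using quotient_map_eqD[OF W s s_eq x] by blast
    let ?V = "W1 \<inter> W2"
    have V: "openin T ?V" "?V \<subseteq> W" using W1 W2 by blast+
    interpret R: cring "sections A ?V" by (rule E.A.cring_sections[OF V(1)])
    have tV: "t ?V = t' ?V"
      using annihilator_restr_apply[OF W1(1) V(1), of W t]
        annihilator_restr_apply[OF W1(1) V(1), of W t'] W1(4) by simp
    have f: "restr E W2 ?V f \<in> secs F ?V" "restr E W2 ?V f \<in> secs E ?V"
      using F_restr_closed[OF W2(1) V(1) _ W2(4)] F_subset[OF V(1)] by auto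
    have s'V: "restr E W ?V s' \<in> secs E ?V" by (rule E.E.restr_closed[OF W V s(2)])
    have fE: "f \<in> secs E W2" using W2 F_subset by blast
    have "restr E W ?V s = restr E W2 ?V (restr E W W2 s)"
      by (rule E.E.restr_restr[symmetric]) (use W V W2 s in auto)
    also have "\<dots> = restr E W2 ?V f \<oplus>\<^bsub>sections E ?V\<^esub> restr E W ?V s'"
      using W V W2 s fE by (simp add: E.restr_add E.E.restr_closed E.E.restr_restr)
    finally have "t ?V (restr E W ?V s) =
        t ?V (restr E W2 ?V f) \<oplus>\<^bsub>sections A ?V\<^esub> t ?V (restr E W ?V s')"
      using sheaf_hom_add[OF th(1) _ f(2) s'V] V by (simp add: SW structure_module_simps)
    also have "t ?V (restr E W2 ?V f) = \<zero>\<^bsub>sections A ?V\<^esub>"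
      using t(1) V f(1) by (simp add: annihilator_secs_iff)
    finally have "t ?V (restr E W ?V s) = t' ?V (restr E W ?V s')"
      using sheaf_hom_closed[OF th(1) _ s'V] V tV by (simp add: SW structure_module_simps)
    then have "restr A W ?V (t W s) = restr A W ?V (t' W s')"
      using sheaf_hom_restr[OF th(1) _ _ _ s(1), of ?V] sheaf_hom_restr[OF th(2) _ _ _ s(2), of ?V]
        V W by (simp add: SW structure_module_simps)
    then show "\<exists>V. openin T V \<and> x \<in> V \<and> V \<subseteq> W \<and> restr A W V (t W s) = restr A W V (t' W s')"
      using V W1(2) W2(2) by (intro exI[of _ ?V]) simp
  qed
qed

text \<open>
  Equal images have locally equal pullbacks, so the two homomorphisms agree on the local sections
  \<open>quotient_map W s\<close>. Every section of the quotient sheaf is locally of that form, and the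
  structure sheaf is separated.
\<close>
lemma dual_to_annihilator_inj:
  assumes U: "openin T U"
  shows "inj_on (dual_to_annihilator U) (secs (dual T A Q) U)"
proof (rule inj_onI)
  fix \<phi> \<phi>' assume \<phi>: "\<phi> \<in> secs (dual T A Q) U" "\<phi>' \<in> secs (dual T A Q) U"
    and "dual_to_annihilator U \<phi> = dual_to_annihilator U \<phi>'"
  then have eq: "generated_unit T N U (pull U \<phi>) = generated_unit T N U (pull U \<phi>')"
    by (simp add: dual_to_annihilator_apply U)
  have SU: "openin (subtopology T U) V \<longleftrightarrow> openin T V \<and> V \<subseteq> U" for V
    using U by (simp add: openin_open_subtopology)
  have hom: "\<phi> \<in> sheaf_homs (subtopology T U) A Q (structure_module A)"
    "\<phi>' \<in> sheaf_homs (subtopology T U) A Q (structure_module A)"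
    using \<phi> by (simp_all add: dual_quotient_secs)
  show "\<phi> = \<phi>'"
  proof (rule sheaf_hom_eqI[OF hom])
    fix V \<tau> assume "openin (subtopology T U) V" and \<tau>: "\<tau> \<in> secs Q V"
    then have V: "openin T V" "V \<subseteq> U" by (simp_all add: SU)
    show "\<phi> V \<tau> = \<phi>' V \<tau>"
    proof (rule E.A.eq_if_locally_eq[OF V(1)])
      show "\<phi> V \<tau> \<in> secs A V" "\<phi>' V \<tau> \<in> secs A V"
        using sheaf_hom_closed[OF hom(1), of V \<tau>] sheaf_hom_closed[OF hom(2), of V \<tau>] \<tau> V
        by (simp_all add: SU structure_module_simps)
      fix x assume x: "x \<in> V"
      then have xU: "x \<in> U" using V by blast
      obtain W where W: "openin T W" "x \<in> W" "W \<subseteq> U"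
        "restr N U W (pull U \<phi>) = restr N U W (pull U \<phi>')"
        using ann.generated_unit_eqD[OF U pull_annihilates[OF U \<phi>(1)]
            pull_annihilates[OF U \<phi>(2)] eq xU] by blast
      obtain W' s where W': "openin T W'" "x \<in> W'" "W' \<subseteq> V" "s \<in> secs E W'"
        "restr Q V W' \<tau> = quotient_map W' s"
        using quotient_map_locally_surj[OF \<tau> x] by blast
      let ?I = "W \<inter> W'"
      have I: "openin T ?I" "?I \<subseteq> V" "?I \<subseteq> U" using W W' V by blast+
      have sI: "restr E W' ?I s \<in> secs E ?I" using W' I by (simp add: E.E.restr_closed)
      have "restr Q V ?I \<tau> = restr Q W' ?I (restr Q V W' \<tau>)"
        by (rule Q.P.restr_restr[symmetric]) (use V I W' \<tau> in auto)
      then have \<tau>I: "restr Q V ?I \<tau> = quotient_map ?I (restr E W' ?I s)"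
        using sheaf_hom_restr[OF quotient_map_in_sheaf_homs W'(1) I(1) _ W'(4)] W'(5) by simp
      have "pull U \<phi> ?I = pull U \<phi>' ?I"
        using annihilator_restr_apply[OF W(1) I(1), of U "pull U \<phi>"]
          annihilator_restr_apply[OF W(1) I(1), of U "pull U \<phi>'"] W(4) by simp
      then have "\<phi> ?I (restr Q V ?I \<tau>) = \<phi>' ?I (restr Q V ?I \<tau>)"
        using pull_apply[OF U \<phi>(1) I(1,3) sI] pull_apply[OF U \<phi>(2) I(1,3) sI] \<tau>I by simp
      then have "restr A V ?I (\<phi> V \<tau>) = restr A V ?I (\<phi>' V \<tau>)"
        using sheaf_hom_restr[OF hom(1) _ _ _ \<tau>, of ?I] sheaf_hom_restr[OF hom(2) _ _ _ \<tau>, of ?I]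
          V I by (simp add: SU structure_module_simps)
      then show "\<exists>W. openin T W \<and> x \<in> W \<and> W \<subseteq> V \<and> restr A V W (\<phi> V \<tau>) = restr A V W (\<phi>' V \<tau>)"
        using I W(2) W'(2) by (intro exI[of _ ?I]) simp
    qed
  qed
qed

text \<open>
  Locally \<open>\<sigma>\<close> comes from annihilating homomorphisms \<open>t\<close> and a section of the quotient sheaf comes from
  sections \<open>s\<close> of \<open>E\<close>. The values \<open>t W s\<close> form a prescription to which \<open>partial_hom_extends\<close> applies.
\<close>
lemma dual_to_annihilator_surj:
  assumes U: "openin T U" and \<sigma>: "\<sigma> \<in> secs (annihilator_sheaf T A E F) U"
  obtains \<phi> where "\<phi> \<in> secs (dual T A Q) U" "dual_to_annihilator U \<phi> = \<sigma>"
proof -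
  let ?S = "subtopology T U" and ?O = "structure_module A"
  have SU: "openin ?S V \<longleftrightarrow> openin T V \<and> V \<subseteq> U" for V
    using U by (simp add: openin_open_subtopology)
  have \<sigma>': "\<sigma> \<in> secs (generated_sheaf T A N) U" using \<sigma> by (simp add: annihilator_sheaf_def)
  define L where "L W \<tau> a \<longleftrightarrow> (\<exists>t\<in>secs N W. \<exists>s\<in>secs E W. restrict \<sigma> W = generated_unit T N W t \<and>
    \<tau> = quotient_map W s \<and> a = t W s)" for W \<tau> a
  have t_restr: "restr N W W' t \<in> secs N W'"
    "restrict \<sigma> W' = generated_unit T N W' (restr N W W' t)"
    if "openin T W" "openin T W'" "W' \<subseteq> W" "t \<in> secs N W" "restrict \<sigma> W = generated_unit T N W t"
    for W W' t
  proof -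
    show "restr N W W' t \<in> secs N W'" using that by (simp add: ann.P.restr_closed)
    have "restrict \<sigma> W' = restrict (restrict \<sigma> W) W'" using that(3) by (simp add: inf.absorb2)
    also have "\<dots> = restrict (generated_unit T N W t) W'" using that by simp
    also have "\<dots> = generated_unit T N W' (restr N W W' t)"
      using sheaf_hom_restr[OF ann.generated_unit_in_sheaf_homs that(1-4)]
      by (simp add: generated_sheaf_def)
    finally show "restrict \<sigma> W' = generated_unit T N W' (restr N W W' t)" .
  qed
  have hom: "t \<in> sheaf_homs (subtopology T W) A E ?O" if "t \<in> secs N W" for W t
    using that by (simp add: annihilator_secs_iff)
  have self: "openin (subtopology T W) W" if "openin T W" for W
    using that by (simp add: openin_open_subtopology)
  have functional: "a = b" if W: "openin T W" and a: "L W \<tau> a" and b: "L W \<tau> b" for W \<tau> a b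
  proof -
    obtain t s where "t \<in> secs N W" "s \<in> secs E W" "restrict \<sigma> W = generated_unit T N W t"
      "\<tau> = quotient_map W s" "a = t W s" using a unfolding L_def by blast
    moreover obtain t' s' where "t' \<in> secs N W" "s' \<in> secs E W"
      "restrict \<sigma> W = generated_unit T N W t'" "\<tau> = quotient_map W s'" "b = t' W s'"
      using b unfolding L_def by blast
    ultimately show ?thesis using annihilator_eval_well_defined[OF W] by metis
  qed
  obtain \<phi> where \<phi>: "\<phi> \<in> sheaf_homs ?S A Q ?O"
    and \<phi>_L: "\<And>W \<tau> a. \<lbrakk>openin ?S W; \<tau> \<in> secs Q W; L W \<tau> a\<rbrakk> \<Longrightarrow> \<phi> W \<tau> = a"
  proof (rule partial_hom_extends[where L = L])
    show "module_presheaf ?S A Q"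
      by (rule module_presheaf_subtopology[OF quotient_sheaf_module_presheaf U])
    show "module_sheaf ?S A ?O"
      by (rule module_sheaf_subtopology[OF O.module_sheaf_axioms U])
    show "a \<in> secs ?O W" if "openin ?S W" "L W \<tau> a" for W \<tau> a
      using that sheaf_hom_closed[OF hom self] unfolding L_def SU by blast
    show "a = b" if "openin ?S W" "L W \<tau> a" "L W \<tau> b" for W \<tau> a b
      using that functional unfolding SU by blast
    show "L W' (restr Q W W' \<tau>) (restr ?O W W' a)"
      if W: "openin ?S W" "openin ?S W'" "W' \<subseteq> W" and L: "L W \<tau> a" for W W' \<tau> a
    proof -
      have W: "openin T W" "openin T W'" "W' \<subseteq> W" using W SU by auto
      obtain t s where ts: "t \<in> secs N W" "s \<in> secs E W" "restrict \<sigma> W = generated_unit T N W t"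
        "\<tau> = quotient_map W s" "a = t W s" using L unfolding L_def by blast
      have "restr Q W W' \<tau> = quotient_map W' (restr E W W' s)"
        using sheaf_hom_restr[OF quotient_map_in_sheaf_homs W ts(2)] ts(4) by simp
      moreover have "restr ?O W W' a = restr N W W' t W' (restr E W W' s)"
        using sheaf_hom_restr[OF hom[OF ts(1)] self[OF W(1)] _ W(3) ts(2)] W ts(5)
        by (simp add: annihilator_restr_apply openin_open_subtopology)
      ultimately show ?thesis
        unfolding L_def using t_restr[OF W ts(1,3)] E.E.restr_closed[OF W ts(2)] by blast
    qed
    show "\<exists>W a. openin ?S W \<and> x \<in> W \<and> W \<subseteq> V \<and> L W (restr Q V W \<tau>) a"
      if V: "openin ?S V" and \<tau>: "\<tau> \<in> secs Q V" and x: "x \<in> V" for V \<tau> x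
    proof -
      have V: "openin T V" "V \<subseteq> U" using V SU by auto
      have xU: "x \<in> U" using x V by blast
      obtain W t where W: "openin T W" "x \<in> W" "W \<subseteq> U" "t \<in> secs N W"
        "restr (generated_sheaf T A N) U W \<sigma> = generated_unit T N W t"
        using ann.generated_unit_locally_surj[OF \<sigma>' xU] by blast
      obtain W' s where W': "openin T W'" "x \<in> W'" "W' \<subseteq> V" "s \<in> secs E W'"
        "restr Q V W' \<tau> = quotient_map W' s"
        using quotient_map_locally_surj[OF \<tau> x] by blast
      let ?I = "W \<inter> W'"
      have I: "openin T ?I" "?I \<subseteq> V" "x \<in> ?I" using W W' by blast+
      have "restr Q V ?I \<tau> = restr Q W' ?I (restr Q V W' \<tau>)"
        by (rule Q.P.restr_restr[symmetric]) (use V I W' \<tau> in auto)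
      then have "restr Q V ?I \<tau> = quotient_map ?I (restr E W' ?I s)"
        using sheaf_hom_restr[OF quotient_map_in_sheaf_homs W'(1) I(1) _ W'(4)] W'(5) by simp
      moreover have "restrict \<sigma> W = generated_unit T N W t"
        using W(5) by (simp add: generated_sheaf_def)
      ultimately have "L ?I (restr Q V ?I \<tau>) (restr N W ?I t ?I (restr E W' ?I s))"
        unfolding L_def using t_restr[OF W(1) I(1) _ W(4)] E.E.restr_closed[OF W'(1) I(1) _ W'(4)]
        by (intro bexI[of _ "restr N W ?I t"] bexI[of _ "restr E W' ?I s"]) simp_all
      moreover have "openin ?S ?I" using I V SU by blast
      ultimately show ?thesis using I by (intro exI conjI)
    qed
    show "L W (\<tau> \<oplus>\<^bsub>sections Q W\<^esub> \<tau>') (a \<oplus>\<^bsub>sections ?O W\<^esub> b)"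
      if W: "openin ?S W" and La: "L W \<tau> a" and Lb: "L W \<tau>' b" for W \<tau> \<tau>' a b
    proof -
      have W: "openin T W" using W SU by auto
      obtain t s where ts: "t \<in> secs N W" "s \<in> secs E W" "restrict \<sigma> W = generated_unit T N W t"
        "\<tau> = quotient_map W s" "a = t W s" using La unfolding L_def by blast
      obtain s' where s': "s' \<in> secs E W" "\<tau>' = quotient_map W s'" using Lb unfolding L_def by blast
      \<comment> \<open>The pair behind \<open>b\<close> may use another representative of \<open>\<sigma>\<close>. Single-valuedness of \<open>L\<close> allows
        \<open>t\<close> to be used for both summands, so that additivity of \<open>t\<close> applies.\<close>
      then have "L W \<tau>' (t W s')" unfolding L_def using ts by blast
      then have b: "b = t W s'" using functional[OF W Lb] by blast
      show ?thesis
        unfolding L_def using ts s' b E.MP.add_closed[OF W ts(2) s'(1)]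
          sheaf_hom_add[OF quotient_map_in_sheaf_homs W ts(2) s'(1)]
          sheaf_hom_add[OF hom[OF ts(1)] self[OF W] ts(2) s'(1)]
        by (intro bexI[of _ t] bexI[of _ "s \<oplus>\<^bsub>sections E W\<^esub> s'"]) simp_all
    qed
    show "L W (c \<odot>\<^bsub>sections Q W\<^esub> \<tau>) (c \<odot>\<^bsub>sections ?O W\<^esub> a)"
      if W: "openin ?S W" and c: "c \<in> secs A W" and La: "L W \<tau> a" for W c \<tau> a
    proof -
      have W: "openin T W" using W SU by auto
      obtain t s where ts: "t \<in> secs N W" "s \<in> secs E W" "restrict \<sigma> W = generated_unit T N W t"
        "\<tau> = quotient_map W s" "a = t W s" using La unfolding L_def by blast
      show ?thesis
        unfolding L_def using ts E.MP.smult_closed[OF W c ts(2)]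
          sheaf_hom_smult[OF quotient_map_in_sheaf_homs W c ts(2)]
          sheaf_hom_smult[OF hom[OF ts(1)] self[OF W] c ts(2)]
        by (intro bexI[of _ t] bexI[of _ "c \<odot>\<^bsub>sections E W\<^esub> s"]) simp_all
    qed
  qed (rule that, assumption, blast)
  have \<phi>D: "\<phi> \<in> secs (dual T A Q) U" using \<phi> by (simp add: dual_quotient_secs)
  have "dual_to_annihilator U \<phi> x = \<sigma> x" for x
  proof (cases "x \<in> U")
    case False
    then show ?thesis
      using \<sigma>' U pull_annihilates[OF U \<phi>D]
      by (simp add: dual_to_annihilator_apply[OF U \<phi>D] generated_unit_def
          generated_sheaf_def extensional_def)
  next
    case True
    obtain W t where W: "openin T W" "x \<in> W" "W \<subseteq> U" "t \<in> secs N W"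
      "restr (generated_sheaf T A N) U W \<sigma> = generated_unit T N W t"
      using ann.generated_unit_locally_surj[OF \<sigma>' True] by blast
    have \<sigma>W: "restrict \<sigma> W = generated_unit T N W t" using W(5) by (simp add: generated_sheaf_def)
    have pN: "restr N U W (pull U \<phi>) \<in> secs N W"
      by (rule ann.P.restr_closed[OF U W(1,3) pull_annihilates[OF U \<phi>D]])
    \<comment> \<open>Near \<open>x\<close> the pullback of \<open>\<phi>\<close> is the local representative \<open>t\<close> of \<open>\<sigma>\<close>, because \<open>\<phi>\<close> takes the
      prescribed values.\<close>
    have "restr N U W (pull U \<phi>) = t"
    proof (rule sheaf_hom_eqI[OF hom[OF pN] hom[OF W(4)]])
      fix V s assume "openin (subtopology T W) V" and s: "s \<in> secs E V"
      then have V: "openin T V" "V \<subseteq> W" "V \<subseteq> U" using W by (auto simp: openin_open_subtopology)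
      have "L V (quotient_map V s) (restr N W V t V s)"
        unfolding L_def using t_restr[OF W(1) V(1,2) W(4) \<sigma>W] s by blast
      then have "\<phi> V (quotient_map V s) = t V s"
        using \<phi>_L[of V] V s sheaf_hom_closed[OF quotient_map_in_sheaf_homs V(1) s]
        by (simp add: SU annihilator_restr_apply)
      then show "restr N U W (pull U \<phi>) V s = t V s"
        using V W by (simp add: annihilator_restr_apply pull_apply[OF U \<phi>D V(1,3) s])
    qed
    then have "germ T N x U (pull U \<phi>) = germ T N x W t"
      using ann.P.germ_restr[OF U pull_annihilates[OF U \<phi>D] W(1,3,2)] by simp
    also have "\<dots> = \<sigma> x"
      using fun_cong[OF \<sigma>W, of x] W by (simp add: generated_unit_def)
    finally show ?thesis
      using True U pull_annihilates[OF U \<phi>D]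
      by (simp add: dual_to_annihilator_apply[OF U \<phi>D] generated_unit_def)
  qed
  then have "dual_to_annihilator U \<phi> = \<sigma>" by blast
  with \<phi>D that show ?thesis by blast
qed

lemma dual_quotient_isomorphic_annihilator:
  "sheaf_isomorphic T A (dual T A Q) (annihilator_sheaf T A E F)"
proof (rule sheaf_isomorphicI_bij_betw[OF dual_quotient_module_presheaf
      dual_to_annihilator_in_sheaf_homs])
  fix U assume U: "openin T U"
  show "bij_betw (dual_to_annihilator U) (secs (dual T A Q) U)
      (secs (annihilator_sheaf T A E F) U)"
    unfolding bij_betw_def
  proof (intro conjI dual_to_annihilator_inj[OF U] subset_antisym subsetI)
    fix \<sigma> assume "\<sigma> \<in> dual_to_annihilator U ` secs (dual T A Q) U"
    then show "\<sigma> \<in> secs (annihilator_sheaf T A E F) U"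
      using sheaf_hom_closed[OF dual_to_annihilator_in_sheaf_homs U] by blast
  next
    fix \<sigma> assume "\<sigma> \<in> secs (annihilator_sheaf T A E F) U"
    then show "\<sigma> \<in> dual_to_annihilator U ` secs (dual T A Q) U"
      using dual_to_annihilator_surj[OF U] by blast
  qed
qed

end

theorem corollary1p4:
  fixes T :: "'a topology"
    and A :: "('a, 'r) algebra_data"
    and E F :: "('a, 'r, 'e) module_data"
  assumes "algebra_sheaf T A"
    and "module_sheaf T A E"
    and "submodule_sheaf T A F E"
  shows "sheaf_isomorphic T A (dual T A (quotient_sheaf T A E F)) (annihilator_sheaf T A E F)"
proof -
  interpret subsheaf_of_modules T A E F
    by (intro subsheaf_of_modules.intro subsheaf_of_modules_axioms.intro assms)
  show ?thesis by (rule dual_quotient_isomorphic_annihilator)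
qed

end
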